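(* Let $F$ be a meromorphic Laplace pair $(\mu_l,\mu_r)$ on the vertical strip $\Omega_{a,b}$, $a<0<b$, with separatrix the imaginary axis $\Re(s)=0$, having finitely many poles, located on the imaginary axis at the distinct points $s=ip_n$, $p_n\in\mathbb{R}$, $1\le n\le N$, and satisfying the Phragmén–Lindelöf condition on $\Omega_{a,b}$. Then for each real $t$ $$\mu_r(t)-\mu_l(t)=\sum_{n=1}^{N}\operatorname{Res}\left((e^{st}-1)\frac{F(s)}{s},\ s=ip_n\right).$$
   Context: For $-\infty\le\alpha<\beta\le+\infty$ put $\Omega_{\alpha,\beta}=\{s\in\mathbb{C}:\alpha<\Re(s)<\beta\}$. Determining functions: a function $\mu:\mathbb{R}\to\mathbb{C}$ of bounded variation on every finite interval is normalized if $\mu(0)=0$ and $\mu(t)=\frac{\mu(t^+)+\mu(t^-)}{2}$ for all $t\in\mathbb{R}$. All determining functions are assumed normalized. The bilateral Laplace–Stieltjes transform is $\mathcal{L}(\mu)(s)=\int_{-\infty}^{+\infty}e^{-st}\,d\mu(t)$ (a convergent improper integral). Laplace pair with separatrix $\Re(s)=0$: a function $F$, holomorphic or meromorphic on $\Omega_{a,b}$ with $a<0<b$, is a Laplace pair $(\mu_l,\mu_r)$ on $\Omega_{a,b}$ if $F(s)=\mathcal{L}(\mu_l)(s)$ for all $s\in\Omega_{a,0}$ and $F(s)=\mathcal{L}(\mu_r)(s)$ for all $s\in\Omega_{0,b}$, the integrals converging there. (Hence all poles of $F$ in $\Omega_{a,b}$ lie on $\Re(s)=0$.) Phragmén–Lindelöf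 condition: a function $F$ meromorphic on $\Omega_{a,b}$ and continuous on the boundary satisfies it if there exist positive constants $A,B,Y$ and $0<K<\frac{\pi}{|b-a|}$ such that, for all $a<x<b$, $|F(x+iy)|\le A e^{Be^{K|y|}}$ whenever $|y|\ge Y$. $\operatorname{Res}(g(s),\,s=s_0)$ denotes the residue of $g$ at $s_0$. *)

theory Defs
  imports "HOL-Complex_Analysis.Complex_Analysis" "HOL-Library.Extended_Real"
begin

definition strip :: "ereal \<Rightarrow> ereal \<Rightarrow> complex set" where
  "strip \<alpha> \<beta> = {s. \<alpha> < ereal (Re s) \<and> ereal (Re s) < \<beta>}"

definition locally_bounded_variation :: "(real \<Rightarrow> complex) \<Rightarrow> bool" where
  "locally_bounded_variation \<mu> \<longleftrightarrow>
     (\<forall>A B. \<exists>M. \<forall>\<D>. \<D> division_of {A..B} \<longrightarrow> (\<Sum>k\<in>\<D>. norm (\<mu> (Sup k) - \<mu> (Inf k))) \<le> M)"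

definition normalized :: "(real \<Rightarrow> complex) \<Rightarrow> bool" where
  "normalized \<mu> \<longleftrightarrow> \<mu> 0 = 0 \<and>
     (\<forall>t. \<exists>u v. (\<mu> \<longlongrightarrow> u) (at_right t) \<and> (\<mu> \<longlongrightarrow> v) (at_left t) \<and> \<mu> t = (u + v) / 2)"

definition determining_function :: "(real \<Rightarrow> complex) \<Rightarrow> bool" where
  "determining_function \<mu> \<longleftrightarrow> locally_bounded_variation \<mu> \<and> normalized \<mu>"

text \<open>
  The Riemann--Stieltjes integral of \<open>f\<close> with respect to \<open>\<mu>\<close> over a compact interval. The radius
  \<open>\<delta>\<close> does not depend on the tag, so the sums converge as the mesh tends to 0 (and not
  merely in the gauge sense). For \<open>f\<close> continuous and \<open>\<mu>\<close> of bounded variation the integral exists.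
\<close>
definition has_stieltjes_integral ::
    "(real \<Rightarrow> complex) \<Rightarrow> (real \<Rightarrow> complex) \<Rightarrow> complex \<Rightarrow> real \<Rightarrow> real \<Rightarrow> bool" where
  "has_stieltjes_integral f \<mu> I A B \<longleftrightarrow>
     (\<forall>\<epsilon>>0. \<exists>\<delta>>0. \<forall>p. p tagged_division_of {A..B} \<and> (\<lambda>x. ball x \<delta>) fine p \<longrightarrow>
        norm ((\<Sum>(x, k)\<in>p. f x * (\<mu> (Sup k) - \<mu> (Inf k))) - I) < \<epsilon>)"

lemma has_stieltjes_integral_unique:
  assumes "has_stieltjes_integral f \<mu> I A B" "has_stieltjes_integral f \<mu> J A B"
  shows "I = J"
proof (rule ccontr)
  assume "I \<noteq> J"
  define e where "e = norm (I - J) / 2"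
  have "e > 0" using \<open>I \<noteq> J\<close> by (simp add: e_def)
  let ?S = "\<lambda>p. \<Sum>(x, k)\<in>p. f x * (\<mu> (Sup k) - \<mu> (Inf k))"
  obtain d1 where d1: "d1 > 0"
    "\<And>p. p tagged_division_of {A..B} \<Longrightarrow> (\<lambda>x. ball x d1) fine p \<Longrightarrow> norm (?S p - I) < e"
    using assms(1)[unfolded has_stieltjes_integral_def, rule_format, OF \<open>e > 0\<close>] by auto
  obtain d2 where d2: "d2 > 0"
    "\<And>p. p tagged_division_of {A..B} \<Longrightarrow> (\<lambda>x. ball x d2) fine p \<Longrightarrow> norm (?S p - J) < e"
    using assms(2)[unfolded has_stieltjes_integral_def, rule_format, OF \<open>e > 0\<close>] by auto
  have "gauge (\<lambda>x::real. ball x (min d1 d2))"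
    using d1(1) d2(1) by (simp add: gauge_def)
  then obtain p where p: "p tagged_division_of {A..B}" "(\<lambda>x. ball x (min d1 d2)) fine p"
    by (rule fine_division_exists_real)
  have "(\<lambda>x. ball x d1) fine p" "(\<lambda>x. ball x d2) fine p"
    by (rule fineI, drule fineD[OF p(2)], auto)+
  from d1(2)[OF p(1) this(1)] d2(2)[OF p(1) this(2)]
  have "norm (I - J) < e + e"
    using norm_triangle_ineq4[of "?S p - J" "?S p - I"] by simp
  then show False by (simp add: e_def)
qed

text \<open>
  The bilateral Laplace--Stieltjes transform of \<open>\<mu>\<close> converges at \<open>s\<close> and has the value \<open>w\<close> there:
  the improper integrals over \<open>[0, \<infinity>)\<close> and \<open>(-\<infinity>, 0]\<close> converge separately (no principal value).
\<close>
definition has_laplace_stieltjes :: "(real \<Rightarrow> complex) \<Rightarrow> complex \<Rightarrow> complex \<Rightarrow> bool" where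
  "has_laplace_stieltjes \<mu> s w \<longleftrightarrow>
     (\<exists>J1 J2 w1 w2.
        (\<forall>R\<ge>0. has_stieltjes_integral (\<lambda>t. exp (- s * of_real t)) \<mu> (J1 R) 0 R) \<and>
        (\<forall>R\<ge>0. has_stieltjes_integral (\<lambda>t. exp (- s * of_real t)) \<mu> (J2 R) (- R) 0) \<and>
        (J1 \<longlongrightarrow> w1) at_top \<and> (J2 \<longlongrightarrow> w2) at_top \<and> w = w1 + w2)"

lemma has_laplace_stieltjes_unique:
  assumes "has_laplace_stieltjes \<mu> s w" "has_laplace_stieltjes \<mu> s w'"
  shows "w = w'"
proof -
  let ?f = "\<lambda>t. exp (- s * of_real t)"
  obtain J1 J2 w1 w2 where J:
    "\<And>R. R \<ge> 0 \<Longrightarrow> has_stieltjes_integral ?f \<mu> (J1 R) 0 R"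
    "\<And>R. R \<ge> 0 \<Longrightarrow> has_stieltjes_integral ?f \<mu> (J2 R) (- R) 0"
    "(J1 \<longlongrightarrow> w1) at_top" "(J2 \<longlongrightarrow> w2) at_top" "w = w1 + w2"
    using assms(1) unfolding has_laplace_stieltjes_def by blast
  obtain K1 K2 v1 v2 where K:
    "\<And>R. R \<ge> 0 \<Longrightarrow> has_stieltjes_integral ?f \<mu> (K1 R) 0 R"
    "\<And>R. R \<ge> 0 \<Longrightarrow> has_stieltjes_integral ?f \<mu> (K2 R) (- R) 0"
    "(K1 \<longlongrightarrow> v1) at_top" "(K2 \<longlongrightarrow> v2) at_top" "w' = v1 + v2"
    using assms(2) unfolding has_laplace_stieltjes_def by blast
  have "eventually (\<lambda>R. J1 R = K1 R) at_top"
    by (intro eventually_mono[OF eventually_ge_at_top[of 0]] has_stieltjes_integral_unique[OF J(1) K(1)])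
  then have 1: "(K1 \<longlongrightarrow> w1) at_top"
    by (rule Lim_transform_eventually[OF J(3)])
  have "eventually (\<lambda>R. J2 R = K2 R) at_top"
    by (intro eventually_mono[OF eventually_ge_at_top[of 0]] has_stieltjes_integral_unique[OF J(2) K(2)])
  then have 2: "(K2 \<longlongrightarrow> w2) at_top"
    by (rule Lim_transform_eventually[OF J(4)])
  have "w1 = v1" by (rule tendsto_unique[OF _ 1 K(3)]) simp
  moreover have "w2 = v2" by (rule tendsto_unique[OF _ 2 K(4)]) simp
  ultimately show ?thesis using J(5) K(5) by simp
qed

text \<open>The separatrix is fixed to be the imaginary axis; the values of \<open>F\<close> on it are unconstrained here.\<close>
definition laplace_pair ::
    "(complex \<Rightarrow> complex) \<Rightarrow> (real \<Rightarrow> complex) \<Rightarrow> (real \<Rightarrow> complex) \<Rightarrow> ereal \<Rightarrow> ereal \<Rightarrow> bool" where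
  "laplace_pair F \<mu>l \<mu>r a b \<longleftrightarrow>
     determining_function \<mu>l \<and> determining_function \<mu>r \<and>
     (\<forall>s\<in>strip a 0. has_laplace_stieltjes \<mu>l s (F s)) \<and>
     (\<forall>s\<in>strip 0 b. has_laplace_stieltjes \<mu>r s (F s))"

text \<open>
  Continuity on the boundary is taken relative to the closed strip. With
  extended real \<open>a\<close>, \<open>b\<close>, an infinite width makes the bound on \<open>K\<close> read \<open>0 < K < 0\<close>.
\<close>
definition phragmen_lindelof :: "(complex \<Rightarrow> complex) \<Rightarrow> ereal \<Rightarrow> ereal \<Rightarrow> bool" where
  "phragmen_lindelof F a b \<longleftrightarrow>
     (\<forall>z\<in>frontier (strip a b). continuous (at z within closure (strip a b)) F) \<and>
     (\<exists>A B Y K. A > 0 \<and> B > 0 \<and> Y > 0 \<and> 0 < K \<and> ereal K < ereal pi / \<bar>b - a\<bar> \<and>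
        (\<forall>x y. a < ereal x \<and> ereal x < b \<and> \<bar>y\<bar> \<ge> Y \<longrightarrow>
           norm (F (Complex x y)) \<le> A * exp (B * exp (K * \<bar>y\<bar>))))"

end

theory Submission
  imports Defs "HOL-Probability.Probability"
begin

text \<open>
  Integration by parts and convergence of the transforms on a whole half strip give constants
  \<open>\<kappa>\<^sub>r\<close>, \<open>\<kappa>\<^sub>l\<close> such that, on each vertical line, \<open>F(s)/s\<close> is the absolutely convergent bilateral Laplace
  transform of \<open>\<mu>\<^sub>r - \<kappa>\<^sub>r\<close>, respectively of \<open>\<mu>\<^sub>l - \<kappa>\<^sub>l\<close>. Multiplying by \<open>exp(\<tau>\<^sup>2 s\<^sup>2 / 2)\<close> amounts to convolving with a
  Gaussian of width \<open>\<tau>\<close>; as the Gaussian is even, the convolution tends pointwise to the normalized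
  determining function as \<open>\<tau>\<close> tends to 0. Hence the integrals of \<open>(exp(st) - 1) F(s)/s exp(\<tau>\<^sup>2 s\<^sup>2 / 2)\<close>
  along a line on the right and one on the left, divided by \<open>2\<pi>i\<close>, tend to \<open>\<mu>\<^sub>r(t)\<close> and \<open>\<mu>\<^sub>l(t)\<close>,
  and their difference is a sum of residues. The shift of contour needs no Phragmen-Lindelof theorem:
  with \<open>m\<close> the centre of the strip and \<open>K < K' < \<pi> / (b - a)\<close>, the extra factor
  \<open>exp(-\<epsilon> cos(K'(s - m)))\<close> is bounded by 1 on the strip and beats the double exponential growth of \<open>F\<close>.
  It is removed by letting \<open>\<epsilon>\<close> tend to 0 for fixed \<open>\<tau>\<close>.
\<close>

section \<open>Stieltjes integrals of normalized functions\<close>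

text \<open>Convergence of a transform only makes \<open>F(s)/s\<close> bounded on a vertical line,
  not integrable, and the growth condition allows \<open>F\<close> to be doubly exponential inside
  the strip. Inversion and contour shift are therefore both out of reach for \<open>F(s)/s\<close>
  itself, and the two smoothing factors answer these two separate obstacles. Their order matters:
  for fixed \<tau> the Gaussian makes the undamped integrand integrable on both lines, so that it
  can serve as the dominating function when \<epsilon> tends to 0. The subtracted constants are
  limits of the determining functions at the end where the weight \<open>exp(-st)\<close> blows up.
  They may differ on the two sides and never have to be computed: the \<open>- 1\<close> in
  \<open>exp(st) - 1\<close> forms the difference of the values at \<open>t\<close> and at 0, where
  a normalized function vanishes. The same \<open>- 1\<close> removes the singularity of
  \<open>1/s\<close> at the origin, so only poles of \<open>F\<close> are crossed. Both smoothing
  factors are entire and tend to 1 uniformly on small circles, which is why the residues pass to the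
  limit.\<close>

definition midpoint_normalized :: "(real \<Rightarrow> complex) \<Rightarrow> bool" where
  "midpoint_normalized f \<longleftrightarrow>
     (\<forall>t. \<exists>u v. (f \<longlongrightarrow> u) (at_right t) \<and> (f \<longlongrightarrow> v) (at_left t) \<and> f t = (u + v) / 2)"

text \<open>Floor plus one is the next grid point strictly to the right of \<open>t\<close>, even
  when \<open>t\<close> itself lies on the grid. Strictness lets these points approach
  \<open>t\<close> along the punctured one-sided filter.\<close>

definition grid_above :: "real \<Rightarrow> real \<Rightarrow> real \<Rightarrow> real" where
  "grid_above A h t = A + h * (of_int \<lfloor>(t - A) / h\<rfloor> + 1)"

definition grid_below :: "real \<Rightarrow> real \<Rightarrow> real \<Rightarrow> real" where
  "grid_below A h t = A + h * (of_int \<lceil>(t - A) / h\<rceil> - 1)"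

lemma grid_above_bounds:
  assumes "h > 0"
  shows "t < grid_above A h t" "grid_above A h t \<le> t + h"
proof -
  have "(t - A) / h < of_int \<lfloor>(t - A) / h\<rfloor> + 1" "of_int \<lfloor>(t - A) / h\<rfloor> \<le> (t - A) / h"
    by linarith+
  then show "t < grid_above A h t" "grid_above A h t \<le> t + h"
    using assms
    by (simp_all only: grid_above_def pos_divide_less_eq pos_le_divide_eq) (simp_all add: algebra_simps)
qed

lemma grid_below_bounds:
  assumes "h > 0"
  shows "grid_below A h t < t" "t - h \<le> grid_below A h t"
proof -
  have "(t - A) / h > of_int \<lceil>(t - A) / h\<rceil> - 1" "of_int \<lceil>(t - A) / h\<rceil> \<ge> (t - A) / h"
    by linarith+
  then show "grid_below A h t < t" "t - h \<le> grid_below A h t"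
    using assms
    by (simp_all only: grid_below_def pos_less_divide_eq pos_divide_le_eq) (simp_all add: algebra_simps)
qed

lemma grid_above_tendsto:
  assumes f: "(f \<longlongrightarrow> u) (at_right t)" and h: "\<And>n. h n > 0" "h \<longlonglongrightarrow> 0"
  shows "(\<lambda>n. f (grid_above A (h n) t)) \<longlonglongrightarrow> u"
proof (rule filterlim_compose[OF f])
  have "(\<lambda>n. grid_above A (h n) t) \<longlonglongrightarrow> t"
    by (rule tendsto_sandwich[of "\<lambda>_. t" _ _ "\<lambda>n. t + h n"])
      (use grid_above_bounds[OF h(1), where t = t and A = A] tendsto_add[OF tendsto_const h(2), of t] in \<open>auto intro!: always_eventually less_imp_le\<close>)
  then show "filterlim (\<lambda>n. grid_above A (h n) t) (at_right t) sequentially"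
    using grid_above_bounds[OF h(1), where t = t and A = A]
    by (auto simp: filterlim_at intro!: always_eventually) (metis less_irrefl)
qed

lemma grid_below_tendsto:
  assumes f: "(f \<longlongrightarrow> u) (at_left t)" and h: "\<And>n. h n > 0" "h \<longlonglongrightarrow> 0"
  shows "(\<lambda>n. f (grid_below A (h n) t)) \<longlonglongrightarrow> u"
proof (rule filterlim_compose[OF f])
  have "(\<lambda>n. grid_below A (h n) t) \<longlonglongrightarrow> t"
    by (rule tendsto_sandwich[of "\<lambda>n. t - h n" _ _ "\<lambda>n. t"])
      (use grid_below_bounds[OF h(1), where t = t and A = A] tendsto_diff[OF tendsto_const h(2), of t] in \<open>auto intro!: always_eventually less_imp_le\<close>)
  then show "filterlim (\<lambda>n. grid_below A (h n) t) (at_left t) sequentially"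
    using grid_below_bounds[OF h(1), where t = t and A = A]
    by (auto simp: filterlim_at intro!: always_eventually) (metis less_irrefl)
qed

text \<open>\<open>f\<close> is the mean of its two one-sided limit functions, and each of these is
  a pointwise limit of functions of an integer-valued index. Composing such an index with a map on
  the integers is measurable whatever \<open>f\<close> is.\<close>

lemma midpoint_normalized_measurable:
  assumes "midpoint_normalized f"
  shows "f \<in> borel_measurable borel"
proof -
  obtain u v where uv: "\<And>t. (f \<longlongrightarrow> u t) (at_right t)" "\<And>t. (f \<longlongrightarrow> v t) (at_left t)"
      "\<And>t. f t = (u t + v t) / 2"
    using assms unfolding midpoint_normalized_def by metis
  let ?h = "\<lambda>n. inverse (real (Suc n))"
  have h: "\<And>n. ?h n > 0" "?h \<longlonglongrightarrow> 0"
    using LIMSEQ_inverse_real_of_nat by auto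
  have "u \<in> borel_measurable borel"
  proof (rule borel_measurable_LIMSEQ_metric)
    show "(\<lambda>n. f (grid_above 0 (?h n) t)) \<longlonglongrightarrow> u t" for t
      by (rule grid_above_tendsto[OF uv(1) h])
    show "(\<lambda>t. f (grid_above 0 (?h n) t)) \<in> borel_measurable borel" for n
    proof -
      have "(\<lambda>k::int. f (0 + ?h n * (of_int k + 1))) \<in> measurable (count_space UNIV) borel"
        by simp
      from measurable_compose[OF _ this, of "\<lambda>t. \<lfloor>(t - 0) / ?h n\<rfloor>" borel] show ?thesis
        unfolding grid_above_def by measurable
    qed
  qed
  moreover have "v \<in> borel_measurable borel"
  proof (rule borel_measurable_LIMSEQ_metric)
    show "(\<lambda>n. f (grid_below 0 (?h n) t)) \<longlonglongrightarrow> v t" for t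
      by (rule grid_below_tendsto[OF uv(2) h])
    show "(\<lambda>t. f (grid_below 0 (?h n) t)) \<in> borel_measurable borel" for n
    proof -
      have "(\<lambda>k::int. f (0 + ?h n * (of_int k - 1))) \<in> measurable (count_space UNIV) borel"
        by simp
      from measurable_compose[OF _ this, of "\<lambda>t. \<lceil>(t - 0) / ?h n\<rceil>" borel] show ?thesis
        unfolding grid_below_def by measurable
    qed
  qed
  ultimately have "(\<lambda>t. (u t + v t) / 2) \<in> borel_measurable borel"
    by measurable
  then show ?thesis
    using uv(3) by presburger
qed

section \<open>Uniform Riemann-Stieltjes sums and integration by parts\<close>

lemma locally_bounded_variation_bounded:
  assumes "locally_bounded_variation \<mu>"
  shows "bounded (\<mu> ` {A..B})"
proof -
  obtain M where M: "\<And>\<D>. \<D> division_of {A..B} \<Longrightarrow> (\<Sum>k\<in>\<D>. norm (\<mu> (Sup k) - \<mu> (Inf k))) \<le> M"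
    using assms unfolding locally_bounded_variation_def by blast
  have "norm (\<mu> t) \<le> norm (\<mu> A) + M" if t: "t \<in> {A..B}" for t
  proof (cases "t = A")
    case True
    \<comment> \<open>The trivial division only serves to show \<open>0 \<le> M\<close>. The
      two-piece division used below would collapse to a single interval when
      \<open>t = A = B\<close>.\<close>
    have "{{A..B}} division_of {A..B}"
      using division_of_self[of A B] t by (simp add: cbox_interval)
    from M[OF this] have "norm (\<mu> B - \<mu> A) \<le> M"
      using t by simp
    then have "0 \<le> M"
      by (rule order_trans[OF norm_ge_zero])
    then show ?thesis using True by simp
  next
    case False
    then have At: "A < t" "t \<le> B" using t by auto
    have "{{A..t}, {t..B}} division_of {A..B}"
    proof (rule division_ofI)
      show "\<exists>a b. k = cbox a b" if "k \<in> {{A..t}, {t..B}}" for k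
        using that by (metis box_real(2) insertE singletonD)
      show "\<Union> {{A..t}, {t..B}} = {A..B}"
        using At by auto
      show "interior k1 \<inter> interior k2 = {}"
        if "k1 \<in> {{A..t}, {t..B}}" "k2 \<in> {{A..t}, {t..B}}" "k1 \<noteq> k2" for k1 k2
        using that by auto
    qed (use At in auto)
    from M[OF this] have "(\<Sum>k\<in>{{A..t}, {t..B}}. norm (\<mu> (Sup k) - \<mu> (Inf k))) \<le> M" .
    moreover have "{A..t} \<noteq> {t..B}"
      using At by (metis atLeastAtMost_iff less_imp_le not_le order_refl)
    ultimately have "norm (\<mu> t - \<mu> A) + norm (\<mu> B - \<mu> t) \<le> M"
      using At by simp
    then have "norm (\<mu> t - \<mu> A) \<le> M"
      using norm_ge_zero[of "\<mu> B - \<mu> t"] by linarith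
    then show ?thesis
      using norm_triangle_ineq2[of "\<mu> t" "\<mu> A"] by linarith
  qed
  then show ?thesis
    unfolding bounded_iff by blast
qed

lemma uniform_tagged_division:
  fixes A h :: real
  assumes h: "h > 0" and n: "n > 0"
    and \<tau>: "\<And>i. i < n \<Longrightarrow> \<tau> i \<in> {A + h * real i..A + h * real (Suc i)}"
  defines "I \<equiv> \<lambda>i. {A + h * real i..A + h * real (Suc i)}"
  shows "(\<lambda>i. (\<tau> i, I i)) ` {..<n} tagged_division_of {A..A + h * real n}"
proof (rule tagged_division_ofI)
  have mono: "A + h * real i \<le> A + h * real j" if "i \<le> j" for i j
    using that h by simp
  have Un: "(\<Union>i<n. I i) = {A..A + h * real n}" if "n > 0" for n
    using that
  proof (induction n rule: nat_induct_non_zero)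
    case (Suc n)
    have "(\<Union>i<Suc n. I i) = {A..A + h * real n} \<union> I n"
      using Suc by (auto simp: lessThan_Suc)
    also have "\<dots> = {A..A + h * real (Suc n)}"
      unfolding I_def by (rule ivl_disj_un_two_touch(4)) (use mono[of 0 n] mono[of n "Suc n"] in auto)
    finally show ?case .
  qed (simp add: I_def lessThan_Suc)
  show "finite ((\<lambda>i. (\<tau> i, I i)) ` {..<n})" by simp
  show "\<exists>a b. K = cbox a b" if "(x, K) \<in> (\<lambda>i. (\<tau> i, I i)) ` {..<n}" for x K
    using that unfolding I_def by (metis (no_types, lifting) box_real(2) imageE snd_conv)
  show "x \<in> K" if "(x, K) \<in> (\<lambda>i. (\<tau> i, I i)) ` {..<n}" for x K
    using that \<tau> by (auto simp: I_def)
  show "\<Union> {K. \<exists>x. (x, K) \<in> (\<lambda>i. (\<tau> i, I i)) ` {..<n}} = {A..A + h * real n}"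
    unfolding Un[OF n, symmetric] by blast
  show "K \<subseteq> {A..A + h * real n}" if "(x, K) \<in> (\<lambda>i. (\<tau> i, I i)) ` {..<n}" for x K
    using that Un[OF n] by auto
  show "interior K1 \<inter> interior K2 = {}"
    if K: "(x1, K1) \<in> (\<lambda>i. (\<tau> i, I i)) ` {..<n}" "(x2, K2) \<in> (\<lambda>i. (\<tau> i, I i)) ` {..<n}"
      and ne: "(x1, K1) \<noteq> (x2, K2)" for x1 K1 x2 K2
  proof -
    obtain i j where ij: "K1 = I i" "K2 = I j" "i \<noteq> j"
      using K ne by auto
    have "interior (I i) \<inter> interior (I j) = {}" if "i < j" for i j
      using mono[of "Suc i" j] that by (auto simp: I_def)
    then show ?thesis
      using ij by (metis Int_commute linorder_neqE_nat)
  qed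
qed

text \<open>Existence of the integral is a hypothesis, so it suffices to feed one family of tagged
  divisions into the definition. The index \<open>n = 0\<close> gives an empty sum and does not
  affect the limit.\<close>

lemma has_stieltjes_integral_uniform_sums:
  assumes S: "has_stieltjes_integral f \<mu> I A B" and AB: "A < B"
  defines "x \<equiv> \<lambda>n i. A + (B - A) / real n * real i"
  assumes \<tau>: "\<And>n i. i < n \<Longrightarrow> \<tau> n i \<in> {x n i..x n (Suc i)}"
  shows "(\<lambda>n. \<Sum>i<n. f (\<tau> n i) * (\<mu> (x n (Suc i)) - \<mu> (x n i))) \<longlonglongrightarrow> I"
proof (rule LIMSEQ_I)
  fix e :: real assume "e > 0"
  then obtain d where d: "d > 0"
    "\<And>p. p tagged_division_of {A..B} \<Longrightarrow> (\<lambda>x. ball x d) fine p \<Longrightarrow>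
        norm ((\<Sum>(x, k)\<in>p. f x * (\<mu> (Sup k) - \<mu> (Inf k))) - I) < e"
    using S unfolding has_stieltjes_integral_def by meson
  \<comment> \<open>For \<open>n \<ge> N\<close> the mesh \<open>(B - A) / n\<close> is smaller than
    \<open>d\<close>, so each cell lies in the ball around its tag wherever the tag sits in the
    cell.\<close>
  obtain N :: nat where N: "real N > (B - A) / d" "N > 0"
  proof -
    obtain N :: nat where "real N > (B - A) / d"
      using reals_Archimedean2 by blast
    moreover have "(B - A) / d > 0"
      using AB d(1) by simp
    ultimately show ?thesis
      using that by (metis less_trans of_nat_0_less_iff)
  qed
  show "\<exists>n0. \<forall>n\<ge>n0. norm ((\<Sum>i<n. f (\<tau> n i) * (\<mu> (x n (Suc i)) - \<mu> (x n i))) - I) < e"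
  proof (intro exI allI impI)
    fix n assume "N \<le> n"
    then have n: "n > 0" "real n > (B - A) / d"
      using N by auto
    define h where "h = (B - A) / real n"
    have h: "h > 0" "h < d" "A + h * real n = B"
      using n AB d by (simp_all add: h_def field_simps)
    let ?p = "(\<lambda>i. (\<tau> n i, {x n i..x n (Suc i)})) ` {..<n}"
    have step: "x n (Suc i) = x n i + h" for i
      by (simp only: x_def h_def of_nat_Suc) (simp only: distrib_left mult_1_right add_ac)
    have p: "?p tagged_division_of {A..B}"
      using uniform_tagged_division[OF h(1) n(1), of "\<tau> n" A] \<tau>[of _ n] h(3)
      by (simp add: x_def h_def)
    have "(\<lambda>x. ball x d) fine ?p"
    proof (rule fineI)
      fix y K assume "(y, K) \<in> ?p"
      then obtain i where i: "i < n" "y = \<tau> n i" "K = {x n i..x n (Suc i)}" by auto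
      show "K \<subseteq> ball y d"
        using \<tau>[OF i(1)] h(2) step[of i] unfolding i by (auto simp: dist_real_def)
    qed
    moreover have "(\<Sum>(x, k)\<in>?p. f x * (\<mu> (Sup k) - \<mu> (Inf k)))
        = (\<Sum>i<n. f (\<tau> n i) * (\<mu> (x n (Suc i)) - \<mu> (x n i)))"
    proof (subst sum.reindex)
      show "inj_on (\<lambda>i. (\<tau> n i, {x n i..x n (Suc i)})) {..<n}"
      proof (rule inj_onI)
        fix i j assume "(\<tau> n i, {x n i..x n (Suc i)}) = (\<tau> n j, {x n j..x n (Suc j)})"
        then have "{x n i..x n i + h} = {x n j..x n j + h}" by (simp add: step)
        then have "x n i = x n j" using h(1) by (simp add: Icc_eq_Icc)
        then show "i = j" using AB n by (simp add: x_def)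
      qed
      show "sum ((\<lambda>(x, k). f x * (\<mu> (Sup k) - \<mu> (Inf k))) \<circ> (\<lambda>i. (\<tau> n i, {x n i..x n (Suc i)}))) {..<n}
          = (\<Sum>i<n. f (\<tau> n i) * (\<mu> (x n (Suc i)) - \<mu> (x n i)))"
        using h(1) by (intro sum.cong) (auto simp: step)
    qed
    ultimately show "norm ((\<Sum>i<n. f (\<tau> n i) * (\<mu> (x n (Suc i)) - \<mu> (x n i))) - I) < e"
      using d(2)[OF p] by simp
  qed
qed

text \<open>The values of \<open>m\<close> at the grid points are left free because
  \<open>grid_below\<close> and \<open>grid_above\<close> are constant on cells that are half-open
  on opposite sides; finitely many points do not change the integral.\<close>

lemma has_integral_step_times_derivative:
  fixes f f' m :: "real \<Rightarrow> complex" and c :: "nat \<Rightarrow> complex"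
  assumes df: "\<And>t. (f has_vector_derivative f' t) (at t)" and h: "h > 0"
    and m: "\<And>i t. A + h * real i < t \<Longrightarrow> t < A + h * real (Suc i) \<Longrightarrow> m t = c i"
  shows "((\<lambda>t. f' t * m t) has_integral
      (\<Sum>i<n. (f (A + h * real (Suc i)) - f (A + h * real i)) * c i)) {A..A + h * real n}"
proof (induction n)
  case 0
  then show ?case by (simp add: has_integral_refl)
next
  case (Suc n)
  let ?a = "A + h * real n" and ?b = "A + h * real (Suc n)"
  have ab: "?a \<le> ?b" using h by simp
  have "(f' has_integral (f ?b - f ?a)) {?a..?b}"
    by (rule fundamental_theorem_of_calculus[OF ab])
      (use df in \<open>auto intro: has_vector_derivative_at_within\<close>)
  then have "((\<lambda>t. f' t * c n) has_integral ((f ?b - f ?a) * c n)) {?a..?b}"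
    by (rule has_integral_mult_left)
  then have "((\<lambda>t. f' t * m t) has_integral ((f ?b - f ?a) * c n)) {?a..?b}"
    by (rule has_integral_spike_finite[of "{?a, ?b}", rotated 2]) (auto intro!: m)
  from has_integral_combine[OF _ ab Suc this] h show ?case
    by simp
qed

text \<open>
  Right tags lead to sums of left limits of \<open>\<mu>\<close> and left tags to sums of right limits. Both kinds of
  sums converge to the same integral, and their average involves \<open>\<mu>\<close> itself, since \<open>\<mu>\<close> is the mean of
  its one-sided limits.
\<close>
lemma stieltjes_integral_by_parts:
  fixes f f' \<mu> :: "real \<Rightarrow> complex"
  assumes mid: "midpoint_normalized \<mu>" and bdd: "\<And>A B. bounded (\<mu> ` {A..B})"
    and df: "\<And>t. (f has_vector_derivative f' t) (at t)" and cont: "continuous_on UNIV f'"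
    and S: "has_stieltjes_integral f \<mu> I A B" and AB: "A \<le> B"
  shows "((\<lambda>t. f' t * \<mu> t) has_integral (f B * \<mu> B - f A * \<mu> A - I)) {A..B}"
proof (cases "A = B")
  case True
  \<comment> \<open>The one-point tagged division has sum 0, which forces the integral over a
    degenerate interval to vanish.\<close>
  have "norm I < e" if "e > 0" for e
  proof -
    obtain d where d: "d > 0"
      "\<And>p. p tagged_division_of {A..B} \<Longrightarrow> (\<lambda>x. ball x d) fine p \<Longrightarrow>
          norm ((\<Sum>(x, k)\<in>p. f x * (\<mu> (Sup k) - \<mu> (Inf k))) - I) < e"
      using S \<open>e > 0\<close> unfolding has_stieltjes_integral_def by meson
    have "{(A, {A..B})} tagged_division_of {A..B}"
      using True by (intro tagged_division_of_self_real) simp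
    from d(2)[OF this] d(1) True show ?thesis
      by (simp add: fine_def)
  qed
  then have "I = 0"
    by (metis less_irrefl zero_less_norm_iff)
  with True show ?thesis
    by (simp add: has_integral_refl)
next
  case False
  with AB have AB: "A < B" by simp
  obtain u v where uv: "\<And>t. (\<mu> \<longlongrightarrow> u t) (at_right t)" "\<And>t. (\<mu> \<longlongrightarrow> v t) (at_left t)"
      "\<And>t. \<mu> t = (u t + v t) / 2"
    using mid unfolding midpoint_normalized_def by metis
  define h where "h n = (B - A) / real (Suc n)" for n
  have h: "h n > 0" "A + h n * real (Suc n) = B" "h n \<le> B - A" for n
  proof -
    show "h n > 0" "A + h n * real (Suc n) = B"
      using AB by (simp_all add: h_def)
    have "(B - A) / real (Suc n) \<le> (B - A) / 1"
      using AB by (intro divide_left_mono) auto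
    then show "h n \<le> B - A" by (simp add: h_def)
  qed
  have h0: "h \<longlonglongrightarrow> 0"
    unfolding h_def by (intro LIMSEQ_Suc lim_const_over_n)
  define x where "x n i = A + h n * real i" for n i
  have idx: "\<lfloor>(t - A) / h n\<rfloor> = int i" "\<lceil>(t - A) / h n\<rceil> = int i + 1"
    if "A + h n * real i < t" "t < A + h n * real (Suc i)" for n i t
  proof -
    have "real i < (t - A) / h n" "(t - A) / h n < real i + 1"
      using that h(1)[of n] by (simp_all add: field_simps)
    then show "\<lfloor>(t - A) / h n\<rfloor> = int i" "\<lceil>(t - A) / h n\<rceil> = int i + 1"
      by linarith+
  qed
  let ?below = "\<lambda>n t. \<mu> (grid_below A (h n) t)" and ?above = "\<lambda>n t. \<mu> (grid_above A (h n) t)"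
  let ?SR = "\<lambda>n. \<Sum>i<Suc n. f (x n (Suc i)) * (\<mu> (x n (Suc i)) - \<mu> (x n i))"
  let ?SL = "\<lambda>n. \<Sum>i<Suc n. f (x n i) * (\<mu> (x n (Suc i)) - \<mu> (x n i))"
  let ?bd = "f B * \<mu> B - f A * \<mu> A"
  have SR: "?SR \<longlonglongrightarrow> I"
    using LIMSEQ_Suc[OF has_stieltjes_integral_uniform_sums[OF S AB,
        where \<tau> = "\<lambda>n i. A + (B - A) / real n * real (Suc i)"]] AB
    unfolding x_def h_def by (simp add: divide_right_mono)
  have SL: "?SL \<longlonglongrightarrow> I"
    using LIMSEQ_Suc[OF has_stieltjes_integral_uniform_sums[OF S AB,
        where \<tau> = "\<lambda>n i. A + (B - A) / real n * real i"]] AB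
    unfolding x_def h_def by (simp add: divide_right_mono)
  have x_ends: "x n 0 = A" "x n (Suc n) = B" for n
    using h(2)[of n] by (simp_all add: x_def)
  have tele: "(\<Sum>i<Suc n. f (x n (Suc i)) * \<mu> (x n (Suc i)) - f (x n i) * \<mu> (x n i)) = ?bd" for n
    using sum_lessThan_telescope[of "\<lambda>i. f (x n i) * \<mu> (x n i)" "Suc n"] x_ends[of n] by simp
  \<comment> \<open>Abel summation: with right tags the increments move onto \<open>f\<close> and
    \<open>\<mu>\<close> is left at the lower end of each cell, which is where
    \<open>grid_below\<close> lands. Left tags give \<open>grid_above\<close> in the same
    way.\<close>
  have below: "((\<lambda>t. f' t * ?below n t) has_integral (?bd - ?SR n)) {A..B}" for n
  proof -
    have "((\<lambda>t. f' t * ?below n t) has_integral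
        (\<Sum>i<Suc n. (f (A + h n * real (Suc i)) - f (A + h n * real i)) * \<mu> (x n i)))
        {A..A + h n * real (Suc n)}"
      by (rule has_integral_step_times_derivative[OF df h(1)])
        (simp add: grid_below_def idx x_def)
    also have "(\<Sum>i<Suc n. (f (A + h n * real (Suc i)) - f (A + h n * real i)) * \<mu> (x n i)) = ?bd - ?SR n"
      unfolding tele[of n, symmetric] sum_subtractf[symmetric]
      by (intro sum.cong) (simp_all add: x_def algebra_simps)
    finally show ?thesis
      unfolding h(2) .
  qed
  have above: "((\<lambda>t. f' t * ?above n t) has_integral (?bd - ?SL n)) {A..B}" for n
  proof -
    have "((\<lambda>t. f' t * ?above n t) has_integral
        (\<Sum>i<Suc n. (f (A + h n * real (Suc i)) - f (A + h n * real i)) * \<mu> (x n (Suc i))))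
        {A..A + h n * real (Suc n)}"
      by (rule has_integral_step_times_derivative[OF df h(1)])
        (simp add: grid_above_def idx x_def add.commute)
    also have "(\<Sum>i<Suc n. (f (A + h n * real (Suc i)) - f (A + h n * real i)) * \<mu> (x n (Suc i)))
        = ?bd - ?SL n"
      unfolding tele[of n, symmetric] sum_subtractf[symmetric]
      by (intro sum.cong) (simp_all add: x_def algebra_simps)
    finally show ?thesis
      unfolding h(2) .
  qed
  let ?F = "\<lambda>n t. f' t * ((?below n t + ?above n t) / 2)"
  have F: "(?F n has_integral (?bd - (?SR n + ?SL n) / 2)) {A..B}" for n
    using has_integral_mult_left[OF has_integral_add[OF below above], where c = "1 / 2"]
    by (simp add: field_simps)
  \<comment> \<open>The grid neighbours of a point of \<open>{A..B}\<close> may leave the interval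
    by up to \<open>h n\<close>, which is at most \<open>B - A\<close>; hence the enlarged
    window.\<close>
  obtain M where M: "\<And>t. t \<in> {A - (B - A)..B + (B - A)} \<Longrightarrow> norm (\<mu> t) \<le> M"
    using bdd[of "A - (B - A)" "B + (B - A)"] unfolding bounded_iff by blast
  have "bounded (f' ` {A..B})"
    by (intro compact_imp_bounded compact_continuous_image continuous_on_subset[OF cont]) auto
  then obtain K where K: "\<And>t. t \<in> {A..B} \<Longrightarrow> norm (f' t) \<le> K"
    unfolding bounded_iff by blast
  have bound: "norm (?F n t) \<le> K * M" if t: "t \<in> {A..B}" for n t
  proof -
    have "norm (?below n t) \<le> M" "norm (?above n t) \<le> M"
      by (rule M; use t h(3)[of n] grid_below_bounds[OF h(1)[of n], where t = t and A = A]
          grid_above_bounds[OF h(1)[of n], where t = t and A = A] in auto)+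
    then have "norm ((?below n t + ?above n t) / 2) \<le> M"
      using norm_triangle_ineq[of "?below n t" "?above n t"] by simp
    then show ?thesis
      using K[OF t] unfolding norm_mult by (intro mult_mono) (auto intro: order_trans[OF norm_ge_zero])
  qed
  \<comment> \<open>The average converges at every \<open>t\<close>, jumps included, so no
    exceptional set has to be discarded.\<close>
  have conv: "(\<lambda>n. ?F n t) \<longlonglongrightarrow> f' t * \<mu> t" if "t \<in> {A..B}" for t
    unfolding uv(3)[of t] add.commute[of "u t"]
    by (intro tendsto_intros grid_below_tendsto[OF uv(2) h(1) h0] grid_above_tendsto[OF uv(1) h(1) h0]) auto
  have "(\<lambda>t. f' t * \<mu> t) integrable_on {A..B}"
    and lim: "(\<lambda>n. integral {A..B} (?F n)) \<longlonglongrightarrow> integral {A..B} (\<lambda>t. f' t * \<mu> t)"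
    by (rule dominated_convergence[where h = "\<lambda>_. K * M" and f = ?F];
        use F bound conv in \<open>auto simp: has_integral_iff\<close>)+
  moreover have "(\<lambda>n. integral {A..B} (?F n)) \<longlonglongrightarrow> ?bd - (I + I) / 2"
    unfolding integral_unique[OF F] by (intro tendsto_intros SR SL) auto
  ultimately show ?thesis
    using LIMSEQ_unique[OF lim] by (auto simp: has_integral_iff)
qed

section \<open>Growth of determining functions\<close>

lemma bounded_mult_image:
  fixes f g :: "'a \<Rightarrow> 'b::real_normed_algebra"
  assumes "bounded (f ` S)" "bounded (g ` S)"
  shows "bounded ((\<lambda>x. f x * g x) ` S)"
proof -
  obtain M N where M: "\<And>x. x \<in> S \<Longrightarrow> norm (f x) \<le> M" and N: "\<And>x. x \<in> S \<Longrightarrow> norm (g x) \<le> N"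
    using assms unfolding bounded_iff by blast
  have "norm (f x * g x) \<le> M * N" if "x \<in> S" for x
    using M[OF that] N[OF that] order_trans[OF norm_ge_zero M[OF that]]
    by (intro order_trans[OF norm_mult_ineq] mult_mono) auto
  then show ?thesis unfolding bounded_iff by blast
qed

lemma bounded_measurable_set_integrable:
  fixes w :: "real \<Rightarrow> complex"
  assumes "w \<in> borel_measurable borel" "bounded (w ` {A..B})"
  shows "set_integrable lborel {A..B} w"
proof -
  obtain M where "\<And>t. t \<in> {A..B} \<Longrightarrow> norm (w t) \<le> M"
    using assms(2) unfolding bounded_iff by blast
  then show ?thesis
    unfolding set_integrable_def using assms(1)
    by (intro integrableI_bounded_set_indicator[where B = M]) (auto simp: emeasure_lborel_Icc_eq)
qed

text \<open>The indefinite integral of a merely measurable bounded \<open>w\<close> need not be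
  differentiable everywhere, so the product rule is replaced by Fubini on the triangle
  \<open>0 \<le> u \<le> t \<le> R\<close>: integrating \<open>E'\<close> over \<open>t\<close>
  first gives \<open>E R - E u\<close>.\<close>

lemma indefinite_integral_by_parts:
  fixes w E E' :: "real \<Rightarrow> complex"
  assumes w: "w \<in> borel_measurable borel" "bounded (w ` {0..R})"
    and E: "\<And>t. (E has_vector_derivative E' t) (at t)" "continuous_on UNIV E'"
  shows "(LINT t:{0..R}|lborel. E' t * (LINT u:{0..t}|lborel. w u))
      = E R * (LINT u:{0..R}|lborel. w u) - (LINT u:{0..R}|lborel. E u * w u)"
proof -
  let ?k = "\<lambda>t u. indicator {0..R} t * (indicator {0..t} u * (E' t * w u))"
  obtain M where M: "\<And>t. t \<in> {0..R} \<Longrightarrow> norm (w t) \<le> M"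
    using w(2) unfolding bounded_iff by blast
  have "bounded (E' ` {0..R})"
    by (intro compact_imp_bounded compact_continuous_image continuous_on_subset[OF E(2)]) auto
  then obtain K where K: "\<And>t. t \<in> {0..R} \<Longrightarrow> norm (E' t) \<le> K"
    unfolding bounded_iff by blast
  have contE: "continuous_on UNIV E"
    using E(1) by (meson continuous_at_imp_continuous_on has_vector_derivative_continuous)
  have [measurable]: "E' \<in> borel_measurable borel" "E \<in> borel_measurable borel" "w \<in> borel_measurable borel"
    using E(2) contE w(1) by (auto intro: borel_measurable_continuous_onI)
  \<comment> \<open>Joint measurability is visible once the moving interval in \<open>u\<close> is
    written as a section of one fixed set in the plane.\<close>
  have ind: "indicator {0..t} u = (indicator {x. 0 \<le> snd x \<and> snd x \<le> fst x} (t, u) :: complex)" for t u :: real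
    by (simp add: indicator_def)
  have [measurable]: "{x::real \<times> real. 0 \<le> snd x \<and> snd x \<le> fst x} \<in> sets (borel \<Otimes>\<^sub>M borel)"
  proof -
    have "{x \<in> space (borel \<Otimes>\<^sub>M borel). 0 \<le> snd x \<and> snd x \<le> (fst x :: real)} \<in> sets (borel \<Otimes>\<^sub>M borel)"
      by measurable
    then show ?thesis by (simp add: space_pair_measure)
  qed
  have meas: "case_prod ?k \<in> borel_measurable (lborel \<Otimes>\<^sub>M lborel)"
    unfolding ind by measurable
  have int: "integrable (lborel \<Otimes>\<^sub>M lborel) (case_prod ?k)"
  proof (rule integrableI_bounded_set[where A = "{0..R} \<times> {0..R}" and B = "K * M"])
    show "AE x in lborel \<Otimes>\<^sub>M lborel. x \<in> {0..R} \<times> {0..R} \<longrightarrow> norm (case_prod ?k x) \<le> K * M"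
    proof (intro AE_I2 impI)
      fix x :: "real \<times> real" assume x: "x \<in> {0..R} \<times> {0..R}"
      then have "norm (E' (fst x) * w (snd x)) \<le> K * M"
        unfolding norm_mult by (intro mult_mono K M) (use order_trans[OF norm_ge_zero K[of 0]] in auto)
      then show "norm (case_prod ?k x) \<le> K * M"
        using norm_ge_zero[of "E' (fst x) * w (snd x)"]
        by (auto simp: indicator_def case_prod_beta intro: order_trans simp del: norm_ge_zero)
    qed
    show "emeasure (lborel \<Otimes>\<^sub>M lborel) ({0..R} \<times> {0..R}) < \<infinity>"
      by (subst lborel.emeasure_pair_measure_Times) (auto simp: ennreal_mult_less_top emeasure_lborel_Icc_eq)
  qed (use meas in \<open>auto simp: indicator_def\<close>)
  have "(LINT t:{0..R}|lborel. E' t * (LINT u:{0..t}|lborel. w u))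
      = (LINT t|lborel. LINT u|lborel. ?k t u)"
    unfolding set_lebesgue_integral_def
  proof (intro Bochner_Integration.integral_cong refl)
    fix t :: real
    have "(LINT u|lborel. ?k t u) = (LINT u|lborel. (indicator {0..R} t * E' t) * (indicat_real {0..t} u *\<^sub>R w u))"
      by (intro Bochner_Integration.integral_cong refl) (simp add: indicator_def)
    also have "\<dots> = indicat_real {0..R} t *\<^sub>R (E' t * (LINT u|lborel. indicat_real {0..t} u *\<^sub>R w u))"
      unfolding integral_mult_right_zero by (simp add: indicator_def)
    finally show "indicat_real {0..R} t *\<^sub>R (E' t * (LINT u|lborel. indicat_real {0..t} u *\<^sub>R w u))
        = (LINT u|lborel. ?k t u)" by simp
  qed
  also have "\<dots> = (LINT u|lborel. LINT t|lborel. ?k t u)"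
    by (rule lborel_pair.Fubini_integral[OF int, symmetric])
  also have "\<dots> = (LINT u:{0..R}|lborel. E R * w u - E u * w u)"
    unfolding set_lebesgue_integral_def
  proof (intro Bochner_Integration.integral_cong refl)
    fix u :: real
    show "(LINT t|lborel. ?k t u) = indicat_real {0..R} u *\<^sub>R (E R * w u - E u * w u)"
    proof (cases "u \<in> {0..R}")
      case True
      have "((\<lambda>t. E' t) has_integral (E R - E u)) {u..R}"
        by (rule fundamental_theorem_of_calculus)
          (use E True in \<open>auto intro: has_vector_derivative_at_within\<close>)
      moreover have "set_integrable lborel {u..R} E'"
        by (intro borel_integrable_atLeastAtMost' continuous_on_subset[OF E(2)]) auto
      ultimately have "(LINT t:{u..R}|lborel. E' t) = E R - E u"
        by (simp add: set_borel_integral_eq_integral(2) integral_unique)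
      moreover have "(LINT t|lborel. ?k t u) = (LINT t:{u..R}|lborel. E' t) * w u"
        unfolding set_lebesgue_integral_def integral_mult_left_zero[symmetric]
        using True by (intro Bochner_Integration.integral_cong refl) (auto simp: indicator_def)
      ultimately show ?thesis
        using True by (simp add: left_diff_distrib)
    next
      case False
      then have "(\<lambda>t. ?k t u) = (\<lambda>t. 0)"
        by (intro ext) (auto simp: indicator_def)
      then show ?thesis using False by (simp only: integral_zero) simp
    qed
  qed
  also have "\<dots> = (LINT u:{0..R}|lborel. E R * w u) - (LINT u:{0..R}|lborel. E u * w u)"
  proof (rule set_integral_diff(2))
    have "bounded (E ` {0..R})"
      by (intro compact_imp_bounded compact_continuous_image continuous_on_subset[OF contE]) auto
    then have "bounded ((\<lambda>u. E u * w u) ` {0..R})"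
      using w(2) by (rule bounded_mult_image)
    then show "set_integrable lborel {0..R} (\<lambda>u. E u * w u)"
      by (intro bounded_measurable_set_integrable) auto
    show "set_integrable lborel {0..R} (\<lambda>u. E R * w u)"
      using bounded_measurable_set_integrable[OF w] by simp
  qed
  finally show ?thesis by simp
qed

lemma exp_linear_has_vector_derivative:
  fixes z :: complex
  shows "((\<lambda>t. exp (z * of_real t)) has_vector_derivative z * exp (z * of_real t)) (at t)"
  by (rule has_vector_derivative_real_field[of "\<lambda>x. exp (z * x)"])
    (auto intro!: derivative_eq_intros)

lemma set_integrable_continuous_times_bounded:
  fixes f w :: "real \<Rightarrow> complex"
  assumes f: "continuous_on UNIV f" and w: "w \<in> borel_measurable borel" "bounded (w ` {A..B})"
  shows "set_integrable lborel {A..B} (\<lambda>t. f t * w t)"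
proof (rule bounded_measurable_set_integrable)
  show "(\<lambda>t. f t * w t) \<in> borel_measurable borel"
    by (intro borel_measurable_times borel_measurable_continuous_onI f w)
  have "bounded (f ` {A..B})"
    by (intro compact_imp_bounded compact_continuous_image continuous_on_subset[OF f]) auto
  then show "bounded ((\<lambda>t. f t * w t) ` {A..B})"
    using w(2) by (rule bounded_mult_image)
qed

text \<open>
  For \<open>J R = \<integral>\<^bsub>[0,R]\<^esub> e\<^bsup>-zt\<^esup> d\<nu>(t)\<close>, integrated by parts, this is \<open>\<nu> R = \<integral>\<^bsub>[0,R]\<^esub> e\<^bsup>zt\<^esup> dJ(t)\<close>,
  integrated by parts.
\<close>
lemma laplace_partial_integral_inversion:
  fixes \<nu> :: "real \<Rightarrow> complex" and z :: complex
  assumes \<nu>: "\<nu> \<in> borel_measurable borel" "\<And>A B. bounded (\<nu> ` {A..B})"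
  defines "J \<equiv> \<lambda>R. exp (- z * of_real R) * \<nu> R + z * integral {0..R} (\<lambda>t. exp (- z * of_real t) * \<nu> t)"
  assumes R: "R \<ge> 0" and z: "z \<noteq> 0"
  shows "((\<lambda>t. exp (z * of_real t) * J t) has_integral (exp (z * of_real R) * J R - \<nu> R) / z) {0..R}"
proof -
  let ?w = "\<lambda>t. exp (- z * of_real t) * \<nu> t"
  have cont: "continuous_on UNIV (\<lambda>t::real. exp (c * of_real t) :: complex)" for c
    by (intro continuous_intros)
  have w: "set_integrable lborel {A..B} ?w" for A B
    by (rule set_integrable_continuous_times_bounded[OF cont \<nu>])
  have w': "?w \<in> borel_measurable borel" "bounded (?w ` {0..R})"
  proof -
    show "?w \<in> borel_measurable borel"
      by (intro borel_measurable_times borel_measurable_continuous_onI \<nu> cont)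
    have "bounded ((\<lambda>t. exp (- z * of_real t)) ` {0..R})"
      by (intro compact_imp_bounded compact_continuous_image continuous_on_subset[OF cont]) auto
    then show "bounded (?w ` {0..R})"
      using \<nu>(2) by (rule bounded_mult_image)
  qed
  have HK: "(LINT u:{A..B}|lborel. ?w u) = integral {A..B} ?w" for A B
    by (rule set_borel_integral_eq_integral(2)[OF w])
  have \<nu>int: "set_integrable lborel {0..R} \<nu>"
    by (rule bounded_measurable_set_integrable[OF \<nu>])
  have contI: "continuous_on {0..R} (\<lambda>t. integral {0..t} ?w)"
    using set_borel_integral_eq_integral(1)[OF w[of 0 R]] by (rule indefinite_integral_continuous_1)
  have int2: "set_integrable lborel {0..R} (\<lambda>t. z * exp (z * of_real t) * integral {0..t} ?w)"
    by (intro borel_integrable_atLeastAtMost' continuous_intros contI)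
  have "(LINT t:{0..R}|lborel. z * exp (z * of_real t) * integral {0..t} ?w)
      = exp (z * of_real R) * integral {0..R} ?w - (LINT u:{0..R}|lborel. exp (z * of_real u) * ?w u)"
    using indefinite_integral_by_parts[OF w', of "\<lambda>t. exp (z * of_real t)" "\<lambda>t. z * exp (z * of_real t)"]
      exp_linear_has_vector_derivative continuous_on_mult_left[OF cont] HK by simp
  moreover have "exp (z * of_real u) * ?w u = \<nu> u" for u
    by (simp add: exp_minus field_simps)
  ultimately have eq: "(LINT t:{0..R}|lborel. z * exp (z * of_real t) * integral {0..t} ?w)
      = exp (z * of_real R) * integral {0..R} ?w - (LINT u:{0..R}|lborel. \<nu> u)"
    by (simp only:)
  have J: "exp (z * of_real t) * J t = \<nu> t + z * exp (z * of_real t) * integral {0..t} ?w" for t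
    by (simp add: J_def algebra_simps flip: exp_add)
  have "((\<lambda>t. exp (z * of_real t) * J t) has_integral
      ((LINT u:{0..R}|lborel. \<nu> u) +
        (LINT t:{0..R}|lborel. z * exp (z * of_real t) * integral {0..t} ?w))) {0..R}"
    unfolding J using set_borel_integral_eq_integral[OF \<nu>int] set_borel_integral_eq_integral[OF int2]
    by (intro has_integral_add) (auto simp: has_integral_iff)
  also have "(LINT u:{0..R}|lborel. \<nu> u) + (LINT t:{0..R}|lborel. z * exp (z * of_real t) * integral {0..t} ?w)
      = (exp (z * of_real R) * J R - \<nu> R) / z"
    unfolding eq J using z by simp
  finally show ?thesis .
qed

text \<open>Convergence enters only through a bound \<open>C\<close> for the partial integrals
  \<open>J\<close>. By the inversion formula, \<nu> differs from \<open>exp (z * R) * J R\<close> by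
  \<phi>, which is \<open>-z\<close> times the integral of \<open>exp (z * t) * J t\<close> over
  \<open>[0, R]\<close>. The integrand is at most \<open>C * exp (\<sigma> * t)\<close> in norm: for
  \<open>\<sigma> > 0\<close> this bounds \<phi> up to a constant term, while for
  \<open>\<sigma> < 0\<close> the integral converges, \<open>c\<close> is the limit of \<phi>, and
  the tail has the required size.\<close>

lemma laplace_halfline_growth:
  fixes \<nu> :: "real \<Rightarrow> complex" and \<sigma> :: real
  assumes \<nu>: "\<nu> \<in> borel_measurable borel" "\<And>A B. bounded (\<nu> ` {A..B})" and \<sigma>: "\<sigma> \<noteq> 0"
  defines "z \<equiv> complex_of_real \<sigma>"
  assumes J: "((\<lambda>R. exp (- z * of_real R) * \<nu> R
      + z * integral {0..R} (\<lambda>t. exp (- z * of_real t) * \<nu> t)) \<longlongrightarrow> w) at_top"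
  shows "\<exists>c C. (\<sigma> > 0 \<longrightarrow> c = 0) \<and> (\<forall>R\<ge>0. norm (\<nu> R - c) \<le> C * exp (\<sigma> * R))"
proof -
  define J where "J R = exp (- z * of_real R) * \<nu> R
      + z * integral {0..R} (\<lambda>t. exp (- z * of_real t) * \<nu> t)" for R
  have nexp: "norm (exp (z * of_real t)) = exp (\<sigma> * t)" for t
    by (simp add: z_def)
  have cont: "continuous_on UNIV (\<lambda>t::real. exp (c * of_real t) :: complex)" for c
    by (intro continuous_intros)
  \<comment> \<open>Convergence bounds \<open>J\<close> beyond some \<open>R0\<close>; on
    \<open>[0, R0]\<close> it is a bounded function plus a continuous one.\<close>
  obtain C where C: "\<And>R. R \<ge> 0 \<Longrightarrow> norm (J R) \<le> C"
  proof -
    have "eventually (\<lambda>R. norm (J R - w) < 1) at_top"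
      using tendstoD[OF J[folded J_def], of 1] by (simp add: dist_norm)
    then obtain R0 where R0: "\<And>R. R \<ge> R0 \<Longrightarrow> norm (J R - w) < 1"
      unfolding eventually_at_top_linorder by blast
    let ?g = "\<lambda>R. integral {0..R} (\<lambda>t. exp (- z * of_real t) * \<nu> t)"
    have "bounded ((\<lambda>t. exp (- z * of_real t)) ` {0..R0})"
      by (intro compact_imp_bounded compact_continuous_image continuous_on_subset[OF cont]) auto
    then have 1: "bounded ((\<lambda>R. exp (- z * of_real R) * \<nu> R) ` {0..R0})"
      using \<nu>(2) by (rule bounded_mult_image)
    have "(\<lambda>t. exp (- z * of_real t) * \<nu> t) integrable_on {0..R0}"
      by (intro set_borel_integral_eq_integral(1) set_integrable_continuous_times_bounded[OF cont \<nu>])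
    then have "bounded ((\<lambda>R. z * ?g R) ` {0..R0})"
      by (intro compact_imp_bounded compact_continuous_image continuous_intros
          indefinite_integral_continuous_1) auto
    with 1 have "bounded ((\<lambda>R. exp (- z * of_real R) * \<nu> R + z * ?g R) ` {0..R0})"
      by (rule bounded_plus_comp)
    then have "bounded (J ` {0..R0})" by (simp add: J_def[abs_def])
    then obtain M where M: "\<And>R. R \<in> {0..R0} \<Longrightarrow> norm (J R) \<le> M"
      unfolding bounded_iff by blast
    have "norm (J R) \<le> max M (norm w + 1)" if "R \<ge> 0" for R
    proof (cases "R \<le> R0")
      case True
      then show ?thesis using M[of R] that by simp
    next
      case False
      then show ?thesis
        using R0[of R] norm_triangle_ineq2[of "J R" w] by simp
    qed
    then show ?thesis by (rule that)
  qed
  then have C0: "C \<ge> 0"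
    by (meson norm_ge_zero order_refl order_trans)
  have "z \<noteq> 0" using \<sigma> by (simp add: z_def)
  note inv = laplace_partial_integral_inversion[OF \<nu> _ \<open>z \<noteq> 0\<close>, folded J_def]
  define \<phi> where "\<phi> R = \<nu> R - exp (z * of_real R) * J R" for R
  have \<phi>diff: "norm (\<phi> R - \<phi> S) \<le> C * \<bar>exp (\<sigma> * S) - exp (\<sigma> * R)\<bar>" if RS: "0 \<le> R" "R \<le> S" for R S
  proof -
    let ?G = "\<lambda>t. exp (z * of_real t) * J t"
    have S: "?G integrable_on {0..S}"
      using inv[of S] RS by (auto simp: has_integral_iff)
    have "integral {0..R} ?G + integral {R..S} ?G = integral {0..S} ?G"
      by (rule Henstock_Kurzweil_Integration.integral_combine[OF RS S])
    moreover have "integral {0..R} ?G = - \<phi> R / z" "integral {0..S} ?G = - \<phi> S / z"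
      using inv[of R] inv[of S] RS by (auto simp: has_integral_iff \<phi>_def)
    ultimately have "- \<phi> R / z + integral {R..S} ?G = - \<phi> S / z" by simp
    then have "integral {R..S} ?G = (\<phi> R - \<phi> S) / z"
      by (simp add: diff_divide_distrib algebra_simps)
    then have eq: "\<phi> R - \<phi> S = z * integral {R..S} ?G"
      using \<open>z \<noteq> 0\<close> by simp
    have "((\<lambda>t. exp (\<sigma> * t)) has_integral (exp (\<sigma> * S) / \<sigma> - exp (\<sigma> * R) / \<sigma>)) {R..S}"
      by (rule fundamental_theorem_of_calculus[OF RS(2)])
        (use \<sigma> in \<open>auto intro!: derivative_eq_intros simp flip: has_real_derivative_iff_has_vector_derivative\<close>)
    from has_integral_mult_right[OF this, of C]
    have E: "((\<lambda>t. C * exp (\<sigma> * t)) has_integral C * (exp (\<sigma> * S) / \<sigma> - exp (\<sigma> * R) / \<sigma>)) {R..S}" .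
    have "norm (integral {R..S} ?G) \<le> integral {R..S} (\<lambda>t. C * exp (\<sigma> * t))"
    proof (rule integral_norm_bound_integral)
      show "?G integrable_on {R..S}"
        by (rule integrable_subinterval_real[OF S]) (use RS in auto)
      show "norm (?G t) \<le> C * exp (\<sigma> * t)" if "t \<in> {R..S}" for t
        using C[of t] that RS by (simp add: norm_mult nexp del: norm_exp_eq_Re)
    qed (use E in \<open>auto simp: has_integral_iff\<close>)
    also have "\<dots> = C * (exp (\<sigma> * S) / \<sigma> - exp (\<sigma> * R) / \<sigma>)"
      using E by (rule integral_unique)
    finally have "norm (\<phi> R - \<phi> S) \<le> \<bar>\<sigma>\<bar> * (C * (exp (\<sigma> * S) / \<sigma> - exp (\<sigma> * R) / \<sigma>))"
      unfolding eq norm_mult by (intro mult_mono) (auto simp: z_def)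
    also have "\<dots> \<le> \<bar>\<bar>\<sigma>\<bar> * (C * (exp (\<sigma> * S) / \<sigma> - exp (\<sigma> * R) / \<sigma>))\<bar>"
      by (rule abs_ge_self)
    also have "\<dots> = C * \<bar>exp (\<sigma> * S) - exp (\<sigma> * R)\<bar>"
      using C0 \<sigma> by (simp add: abs_mult flip: diff_divide_distrib)
    finally show ?thesis .
  qed
  have \<nu>\<phi>: "norm (\<nu> R - c) \<le> C * exp (\<sigma> * R) + norm (\<phi> R - c)" if "R \<ge> 0" for R c
  proof -
    have eq: "\<nu> R - c = exp (z * of_real R) * J R + (\<phi> R - c)" by (simp add: \<phi>_def)
    have "norm (exp (z * of_real R) * J R) \<le> C * exp (\<sigma> * R)"
      using C[OF that] by (simp add: norm_mult nexp del: norm_exp_eq_Re)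
    then show ?thesis
      unfolding eq by (intro norm_triangle_le add_right_mono)
  qed
  show ?thesis
  proof (cases "\<sigma> > 0")
    case True
    have "norm (\<nu> R - 0) \<le> (2 * C + norm (\<phi> 0)) * exp (\<sigma> * R)" if R: "R \<ge> 0" for R
    proof -
      have "norm (\<phi> R) \<le> norm (\<phi> 0) + norm (\<phi> 0 - \<phi> R)"
        using norm_triangle_ineq4[of "\<phi> 0" "\<phi> 0 - \<phi> R"] by simp
      moreover have "norm (\<phi> 0 - \<phi> R) \<le> C * exp (\<sigma> * R)"
      proof -
        have "\<bar>exp (\<sigma> * R) - exp (\<sigma> * 0)\<bar> \<le> exp (\<sigma> * R)"
          using R True by simp
        then show ?thesis
          using \<phi>diff[of 0 R] R mult_left_mono[OF _ C0] by (meson order_refl order_trans)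
      qed
      moreover have "norm (\<phi> 0) * 1 \<le> norm (\<phi> 0) * exp (\<sigma> * R)"
        using R True by (intro mult_left_mono) auto
      ultimately show ?thesis
        using \<nu>\<phi>[OF R, of 0] by (simp add: algebra_simps)
    qed
    then show ?thesis by blast
  next
    case False
    then have neg: "\<sigma> < 0" using \<sigma> by simp
    have le: "norm (\<phi> R - \<phi> S) \<le> C * exp (\<sigma> * R)" if "0 \<le> R" "R \<le> S" for R S
    proof -
      have "exp (\<sigma> * S) \<le> exp (\<sigma> * R)" using that neg by simp
      then have "\<bar>exp (\<sigma> * S) - exp (\<sigma> * R)\<bar> \<le> exp (\<sigma> * R)"
        using exp_gt_zero[of "\<sigma> * S"] by linarith
      then show ?thesis
        using \<phi>diff[OF that] mult_left_mono[OF _ C0] by (meson order_trans)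
    qed
    have "((\<lambda>R. C * exp (\<sigma> * R)) \<longlongrightarrow> C * 0) at_top"
      by (intro tendsto_intros filterlim_compose[OF exp_at_bot]
          filterlim_tendsto_neg_mult_at_bot[OF tendsto_const neg filterlim_ident])
    then have lim: "(\<lambda>n. C * exp (\<sigma> * real n)) \<longlonglongrightarrow> 0"
      using filterlim_compose[OF _ filterlim_real_sequentially] by simp
    \<comment> \<open>Sampling at integers is enough: \<open>le\<close> compares
      \<open>\<phi> R\<close> with every later value, so the limit along the integers also controls
      real \<open>R\<close>.\<close>
    have "Cauchy (\<lambda>n. \<phi> (real n))"
    proof (rule CauchyI')
      fix e :: real assume "e > 0"
      then obtain N where N: "\<And>n. n \<ge> N \<Longrightarrow> C * exp (\<sigma> * real n) < e"
        using order_tendstoD(2)[OF lim] unfolding eventually_sequentially by blast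
      have "dist (\<phi> (real m)) (\<phi> (real n)) < e" if "m \<ge> N" "m < n" for m n
        using le[of "real m" "real n"] N[OF that(1)] that by (simp add: dist_norm)
      then show "\<exists>M. \<forall>m\<ge>M. \<forall>n>m. dist (\<phi> (real m)) (\<phi> (real n)) < e"
        by blast
    qed
    then obtain c where c: "(\<lambda>n. \<phi> (real n)) \<longlonglongrightarrow> c"
      using Cauchy_convergent_iff convergent_def by blast
    have "norm (\<phi> R - c) \<le> C * exp (\<sigma> * R)" if R: "R \<ge> 0" for R
    proof (rule tendsto_upperbound)
      show "(\<lambda>n. norm (\<phi> R - \<phi> (real n))) \<longlonglongrightarrow> norm (\<phi> R - c)"
        by (intro tendsto_intros c)
      show "eventually (\<lambda>n. norm (\<phi> R - \<phi> (real n)) \<le> C * exp (\<sigma> * R)) sequentially"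
        using eventually_ge_at_top[of "nat \<lceil>R\<rceil>"]
        by (rule eventually_mono) (intro le R, linarith)
    qed simp
    then have "norm (\<nu> R - c) \<le> (2 * C) * exp (\<sigma> * R)" if "R \<ge> 0" for R
      using \<nu>\<phi>[OF that, of c] that by fastforce
    then show ?thesis using False by blast
  qed
qed

section \<open>Growth bounds on the whole line\<close>

lemma determining_functionD:
  assumes "determining_function \<mu>"
  shows "midpoint_normalized \<mu>" "\<mu> 0 = 0" "\<mu> \<in> borel_measurable borel" "bounded (\<mu> ` {A..B})"
proof -
  show "midpoint_normalized \<mu>" "\<mu> 0 = 0"
    using assms by (auto simp: determining_function_def normalized_def midpoint_normalized_def)
  then show "\<mu> \<in> borel_measurable borel"
    by (intro midpoint_normalized_measurable)
  show "bounded (\<mu> ` {A..B})"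
    using assms by (intro locally_bounded_variation_bounded) (simp add: determining_function_def)
qed

lemma laplace_stieltjes_integral_by_parts:
  assumes \<mu>: "midpoint_normalized \<mu>" "\<And>A B. bounded (\<mu> ` {A..B})"
    and S: "has_stieltjes_integral (\<lambda>t. exp (- s * of_real t)) \<mu> I A B" and AB: "A \<le> B"
  shows "I = exp (- s * of_real B) * \<mu> B - exp (- s * of_real A) * \<mu> A
      + s * integral {A..B} (\<lambda>t. exp (- s * of_real t) * \<mu> t)"
proof -
  have cont: "continuous_on UNIV (\<lambda>t::real. - s * exp (- s * of_real t) :: complex)"
    by (intro continuous_intros)
  have "integral {A..B} (\<lambda>t. - s * exp (- s * of_real t) * \<mu> t)
      = exp (- s * of_real B) * \<mu> B - exp (- s * of_real A) * \<mu> A - I"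
    by (rule integral_unique)
      (rule stieltjes_integral_by_parts[OF \<mu> exp_linear_has_vector_derivative cont S AB])
  moreover have "integral {A..B} (\<lambda>t. - s * exp (- s * of_real t) * \<mu> t)
      = - s * integral {A..B} (\<lambda>t. exp (- s * of_real t) * \<mu> t)"
    unfolding mult.assoc by (rule integral_mult_right)
  ultimately show ?thesis
    by (simp add: algebra_simps)
qed

text \<open>\<open>\<kappa>\<close> is the limit of \<open>\<mu>\<close> at \<open>-\<infinity>\<close> if \<open>\<sigma> > 0\<close>, and at \<open>\<infinity>\<close> if \<open>\<sigma> < 0\<close>.\<close>
lemma laplace_stieltjes_growth:
  assumes \<mu>: "determining_function \<mu>" and L: "has_laplace_stieltjes \<mu> (of_real \<sigma>) w" and \<sigma>: "\<sigma> \<noteq> 0"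
  shows "\<exists>\<kappa> C. \<forall>t. norm (\<mu> t - \<kappa>) \<le> C * exp (\<sigma> * t)"
proof -
  note \<mu>' = determining_functionD[OF \<mu>]
  let ?s = "complex_of_real \<sigma>"
  obtain J1 J2 w1 w2 where J:
    "\<And>R. R \<ge> 0 \<Longrightarrow> has_stieltjes_integral (\<lambda>t. exp (- ?s * of_real t)) \<mu> (J1 R) 0 R"
    "\<And>R. R \<ge> 0 \<Longrightarrow> has_stieltjes_integral (\<lambda>t. exp (- ?s * of_real t)) \<mu> (J2 R) (- R) 0"
    "(J1 \<longlongrightarrow> w1) at_top" "(J2 \<longlongrightarrow> w2) at_top"
    using L unfolding has_laplace_stieltjes_def by blast
  \<comment> \<open>Reflection turns the integral over \<open>[-R, 0]\<close> into one over
    \<open>[0, R]\<close> with \<sigma> replaced by \<open>-\<sigma>\<close>. The outer minus sign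
    keeps the orientation of the increments.\<close>
  define \<nu> where "\<nu> u = - \<mu> (- u)" for u
  have ev0: "eventually (\<lambda>R::real. R \<ge> 0) at_top" by (rule eventually_ge_at_top)
  have 1: "((\<lambda>R. exp (- ?s * of_real R) * \<mu> R
      + ?s * integral {0..R} (\<lambda>t. exp (- ?s * of_real t) * \<mu> t)) \<longlongrightarrow> w1) at_top"
  proof (rule Lim_transform_eventually[OF J(3)], rule eventually_mono[OF ev0])
    fix R :: real assume R: "R \<ge> 0"
    show "J1 R = exp (- ?s * of_real R) * \<mu> R
        + ?s * integral {0..R} (\<lambda>t. exp (- ?s * of_real t) * \<mu> t)"
      using laplace_stieltjes_integral_by_parts[OF \<mu>'(1,4) J(1)[OF R] R] \<mu>'(2) by simp
  qed
  have 2: "((\<lambda>R. exp (- complex_of_real (- \<sigma>) * of_real R) * \<nu> R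
      + complex_of_real (- \<sigma>) * integral {0..R} (\<lambda>t. exp (- complex_of_real (- \<sigma>) * of_real t) * \<nu> t))
      \<longlongrightarrow> w2) at_top"
  proof (rule Lim_transform_eventually[OF J(4)], rule eventually_mono[OF ev0])
    fix R :: real assume R: "R \<ge> 0"
    have "integral {-R..-0} (\<lambda>t. (\<lambda>u. exp (?s * of_real u) * - \<nu> u) (- t))
        = integral {0..R} (\<lambda>u. exp (?s * of_real u) * - \<nu> u)"
      by (rule Henstock_Kurzweil_Integration.integral_reflect_real)
    then have "integral {-R..0} (\<lambda>t. exp (- ?s * of_real t) * \<mu> t)
        = - integral {0..R} (\<lambda>u. exp (?s * of_real u) * \<nu> u)"
      by (simp add: \<nu>_def)
    then show "J2 R = exp (- complex_of_real (- \<sigma>) * of_real R) * \<nu> R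
      + complex_of_real (- \<sigma>) * integral {0..R} (\<lambda>t. exp (- complex_of_real (- \<sigma>) * of_real t) * \<nu> t)"
      using laplace_stieltjes_integral_by_parts[OF \<mu>'(1,4) J(2)[OF R]] R \<mu>'(2) by (simp add: \<nu>_def)
  qed
  have \<nu>: "\<nu> \<in> borel_measurable borel" "bounded (\<nu> ` {A..B})" for A B
  proof -
    show "\<nu> \<in> borel_measurable borel"
      unfolding \<nu>_def using \<mu>'(3) by measurable
    obtain M where "\<And>t. t \<in> {-B..-A} \<Longrightarrow> norm (\<mu> t) \<le> M"
      using \<mu>'(4)[of "-B" "-A"] unfolding bounded_iff by blast
    then have "norm (\<nu> u) \<le> M" if "u \<in> {A..B}" for u
      using that by (simp add: \<nu>_def)
    then show "bounded (\<nu> ` {A..B})"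
      unfolding bounded_iff by blast
  qed
  obtain c1 C1 where c1: "\<sigma> > 0 \<longrightarrow> c1 = 0" "\<And>R. R \<ge> 0 \<Longrightarrow> norm (\<mu> R - c1) \<le> C1 * exp (\<sigma> * R)"
    using laplace_halfline_growth[OF \<mu>'(3,4) \<sigma> 1] by blast
  obtain c2 C2 where c2: "- \<sigma> > 0 \<longrightarrow> c2 = 0" "\<And>R. R \<ge> 0 \<Longrightarrow> norm (\<nu> R - c2) \<le> C2 * exp (- \<sigma> * R)"
    using laplace_halfline_growth[OF \<nu> _ 2] \<sigma> by auto
  \<comment> \<open>One of \<open>c1\<close>, \<open>c2\<close> is 0 according to the sign of
    \<sigma>, and \<kappa> takes the other; \<open>c2\<close> changes sign because it belongs to the
    reflected function. On the half line where the constant was 0,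
    \<open>exp (\<sigma> * t) \<ge> 1\<close>, so subtracting \<kappa> costs only the summand
    \<open>norm \<kappa>\<close> in the constant, as \<open>flex\<close> records.\<close>
  define \<kappa> where "\<kappa> = (if \<sigma> > 0 then - c2 else c1)"
  have "norm (\<mu> t - \<kappa>) \<le> (max C1 C2 + norm \<kappa>) * exp (\<sigma> * t)" for t
  proof -
    have flex: "norm (x - \<kappa>) \<le> (max C1 C2 + norm \<kappa>) * exp (\<sigma> * t)"
      if "norm (x - \<kappa>') \<le> C * exp (\<sigma> * t)" "C \<le> max C1 C2" "\<kappa>' = \<kappa> \<or> (\<kappa>' = 0 \<and> \<sigma> * t \<ge> 0)" for x \<kappa>' C
    proof -
      have "norm (x - \<kappa>') \<le> max C1 C2 * exp (\<sigma> * t)"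
        by (rule order_trans[OF that(1) mult_right_mono[OF that(2)]]) simp
      moreover have "norm (\<kappa>' - \<kappa>) \<le> norm \<kappa> * exp (\<sigma> * t)"
        using that(3) mult_left_mono[of 1 "exp (\<sigma> * t)" "norm \<kappa>"] by auto
      ultimately show ?thesis
        using norm_triangle_ineq[of "x - \<kappa>'" "\<kappa>' - \<kappa>"] by (simp add: algebra_simps)
    qed
    show ?thesis
    proof (cases "t \<ge> 0")
      case True
      show ?thesis
        by (rule flex[OF c1(2)[OF True]]) (use c1(1) \<sigma> True in \<open>auto simp: \<kappa>_def\<close>)
    next
      case False
      have "norm (\<mu> t - (- c2)) \<le> C2 * exp (\<sigma> * t)"
        using c2(2)[of "- t"] False norm_minus_cancel[of "\<mu> t + c2"] by (simp add: \<nu>_def norm_minus_commute)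
      then show ?thesis
        by (rule flex) (use c2(1) \<sigma> False in \<open>auto simp: \<kappa>_def mult_nonpos_nonpos\<close>)
    qed
  qed
  then show ?thesis by blast
qed

text \<open>Two abscissas of the same sign are needed because a single exponential bound becomes
  useless at one end once it is weighted along a line through that abscissa. Both constants are
  limits of \<open>\<mu>\<close> at the same end, hence equal.\<close>

lemma laplace_stieltjes_growth2:
  assumes \<mu>: "determining_function \<mu>"
    and L: "has_laplace_stieltjes \<mu> (of_real \<sigma>1) w1" "has_laplace_stieltjes \<mu> (of_real \<sigma>2) w2"
    and \<sigma>: "\<sigma>1 * \<sigma>2 > 0"
  obtains \<kappa> C where "\<And>t. norm (\<mu> t - \<kappa>) \<le> C * exp (\<sigma>1 * t)" "\<And>t. norm (\<mu> t - \<kappa>) \<le> C * exp (\<sigma>2 * t)"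
proof -
  obtain \<kappa>1 C1 \<kappa>2 C2 where
    1: "\<And>t. norm (\<mu> t - \<kappa>1) \<le> C1 * exp (\<sigma>1 * t)" and 2: "\<And>t. norm (\<mu> t - \<kappa>2) \<le> C2 * exp (\<sigma>2 * t)"
    using laplace_stieltjes_growth[OF \<mu> L(1)] laplace_stieltjes_growth[OF \<mu> L(2)] \<sigma> by fastforce
  have eq: "\<kappa>1 = \<kappa>2"
  proof -
    \<comment> \<open>The point \<open>- sgn \<sigma>1 * R\<close> runs to the end of the real line
      where both exponentials vanish.\<close>
    have lim: "((\<lambda>R. C * exp (\<sigma> * (- sgn \<sigma>1 * R))) \<longlongrightarrow> C * 0) at_top" if "\<sigma> * \<sigma>1 > 0" for C \<sigma>
    proof -
      have "\<sigma> * (- sgn \<sigma>1) < 0"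
        using that by (auto simp: zero_less_mult_iff sgn_if)
      then have "filterlim (\<lambda>R. (\<sigma> * (- sgn \<sigma>1)) * R) at_bot at_top"
        by (intro filterlim_tendsto_neg_mult_at_bot[OF tendsto_const _ filterlim_ident])
      then show ?thesis
        unfolding mult.assoc by (intro tendsto_intros filterlim_compose[OF exp_at_bot])
    qed
    have lim0: "((\<lambda>R. C1 * exp (\<sigma>1 * (- sgn \<sigma>1 * R)) + C2 * exp (\<sigma>2 * (- sgn \<sigma>1 * R))) \<longlongrightarrow> C1 * 0 + C2 * 0) at_top"
      using \<sigma> by (intro tendsto_add lim) (auto simp: mult.commute zero_less_mult_iff)
    have bnd: "norm (\<kappa>1 - \<kappa>2) \<le> C1 * exp (\<sigma>1 * t) + C2 * exp (\<sigma>2 * t)" for t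
      using norm_triangle_ineq4[of "\<mu> t - \<kappa>2" "\<mu> t - \<kappa>1"] 1[of t] 2[of t] by simp
    have "norm (\<kappa>1 - \<kappa>2) \<le> C1 * 0 + C2 * 0"
      by (rule tendsto_lowerbound[OF lim0 always_eventually[OF allI[OF bnd]]]) simp
    then show ?thesis by simp
  qed
  show ?thesis
  proof (rule that)
    show "norm (\<mu> t - \<kappa>1) \<le> max C1 C2 * exp (\<sigma>1 * t)" "norm (\<mu> t - \<kappa>1) \<le> max C1 C2 * exp (\<sigma>2 * t)" for t
      using order_trans[OF 1[of t] mult_right_mono[of C1 "max C1 C2"]]
        order_trans[OF 2[of t] mult_right_mono[of C2 "max C1 C2"]] eq by simp_all
  qed
qed

section \<open>Absolutely convergent Laplace transforms\<close>

lemma midpoint_normalized_diff_const: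
  assumes "midpoint_normalized f"
  shows "midpoint_normalized (\<lambda>u. f u - \<kappa>)"
  unfolding midpoint_normalized_def
proof
  fix t
  obtain u v where "(f \<longlongrightarrow> u) (at_right t)" "(f \<longlongrightarrow> v) (at_left t)" "f t = (u + v) / 2"
    using assms unfolding midpoint_normalized_def by blast
  then show "\<exists>u v. ((\<lambda>u. f u - \<kappa>) \<longlongrightarrow> u) (at_right t) \<and> ((\<lambda>u. f u - \<kappa>) \<longlongrightarrow> v) (at_left t)
      \<and> f t - \<kappa> = (u + v) / 2"
    by (intro exI[of _ "u - \<kappa>"] exI[of _ "v - \<kappa>"]) (auto intro!: tendsto_intros simp: field_simps)
qed

lemma integrable_exp_neg_abs:
  assumes "\<eta> > 0"
  shows "integrable lborel (\<lambda>u::real. exp (- \<eta> * \<bar>u\<bar>))"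
proof -
  have 1: "integrable lborel (\<lambda>u. indicator {0<..} u *\<^sub>R exp (- (u * \<eta>)))"
    using integrable_I0i_exp_mscale[OF assms] by (simp add: set_integrable_def)
  from lborel_integrable_real_affine[OF this, of "-1" 0]
  have 2: "integrable lborel (\<lambda>u. indicator {..<0} u *\<^sub>R exp (u * \<eta>))"
    by (simp add: indicator_def)
  have "integrable lborel (\<lambda>u. indicator {0<..} u *\<^sub>R exp (- (u * \<eta>)) + indicator {..<0} u *\<^sub>R exp (u * \<eta>))"
    using 1 2 by (rule Bochner_Integration.integrable_add)
  then show ?thesis
    by (rule integrable_discrete_difference[where X = "{0}", THEN iffD1, rotated -1])
      (auto simp: indicator_def mult.commute)
qed

text \<open>For \<open>t \<ge> 0\<close> the smaller exponent \<sigma>1 gains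
  \<open>c - \<sigma>1\<close> over \<open>c\<close>, and for \<open>t < 0\<close> the larger one
  gains \<open>\<sigma>2 - c\<close>; the minimum is a decay rate valid at both ends.\<close>

lemma min_exp_le:
  fixes x C :: real
  assumes "x \<le> C * exp (\<sigma>1 * t)" "x \<le> C * exp (\<sigma>2 * t)" "C \<ge> 0" "\<sigma>1 < c" "c < \<sigma>2"
  shows "x \<le> C * exp (c * t - min (c - \<sigma>1) (\<sigma>2 - c) * \<bar>t\<bar>)"
proof (cases "t \<ge> 0")
  case True
  then have "min (c - \<sigma>1) (\<sigma>2 - c) * t \<le> (c - \<sigma>1) * t"
    by (intro mult_right_mono) auto
  then have "exp (\<sigma>1 * t) \<le> exp (c * t - min (c - \<sigma>1) (\<sigma>2 - c) * \<bar>t\<bar>)"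
    using True by (simp add: algebra_simps)
  then show ?thesis
    using assms(1) mult_left_mono[OF _ assms(3)] by (meson order_trans)
next
  case False
  then have "min (c - \<sigma>1) (\<sigma>2 - c) * (- t) \<le> (\<sigma>2 - c) * (- t)"
    by (intro mult_right_mono) auto
  then have "exp (\<sigma>2 * t) \<le> exp (c * t - min (c - \<sigma>1) (\<sigma>2 - c) * \<bar>t\<bar>)"
    using False by (simp add: algebra_simps)
  then show ?thesis
    using assms(2) mult_left_mono[OF _ assms(3)] by (meson order_trans)
qed

lemma exp_weight_bound:
  fixes g :: "real \<Rightarrow> complex"
  assumes g: "\<And>u. norm (g u) \<le> C * exp (c * u - \<eta> * \<bar>u\<bar>)" and s: "Re s = c"
  shows "norm (exp (- s * of_real u) * g u) \<le> C * exp (- \<eta> * \<bar>u\<bar>)"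
proof -
  have "norm (exp (- s * of_real u) * g u) = exp (- c * u) * norm (g u)"
    using s by (simp add: norm_mult)
  also have "\<dots> \<le> exp (- c * u) * (C * exp (c * u - \<eta> * \<bar>u\<bar>))"
    by (intro mult_left_mono g) auto
  also have "\<dots> = C * (exp (- c * u) * exp (c * u - \<eta> * \<bar>u\<bar>))" by simp
  also have "exp (- c * u) * exp (c * u - \<eta> * \<bar>u\<bar>) = exp (- \<eta> * \<bar>u\<bar>)"
    by (simp flip: exp_add)
  finally show ?thesis .
qed

lemma exp_weight_integrable:
  fixes g :: "real \<Rightarrow> complex"
  assumes g: "\<And>u. norm (g u) \<le> C * exp (c * u - \<eta> * \<bar>u\<bar>)" and s: "Re s = c"
    and "g \<in> borel_measurable borel" "\<eta> > 0"
  shows "integrable lborel (\<lambda>u. exp (- s * of_real u) * g u)"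
proof (rule Bochner_Integration.integrable_bound)
  show "integrable lborel (\<lambda>u. C * exp (- \<eta> * \<bar>u\<bar>))"
    using integrable_exp_neg_abs[OF assms(4)] by simp
  show "(\<lambda>u. exp (- s * of_real u) * g u) \<in> borel_measurable lborel"
    using assms(3) by measurable
  show "AE u in lborel. norm (exp (- s * of_real u) * g u) \<le> norm (C * exp (- \<eta> * \<bar>u\<bar>))"
    using exp_weight_bound[OF g s] by (intro AE_I2) (metis order_trans real_norm_def abs_ge_self)
qed

lemma tendsto_integral_symmetric_intervals:
  fixes f :: "real \<Rightarrow> complex"
  assumes int: "integrable lborel f"
  shows "(\<lambda>n. LINT u:{- real n..real n}|lborel. f u) \<longlonglongrightarrow> (LINT u|lborel. f u)"
  unfolding set_lebesgue_integral_def
proof (rule integral_dominated_convergence)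
  show "integrable lborel (\<lambda>u. norm (f u))" using int by simp
  show "AE u in lborel. (\<lambda>n. indicator {- real n..real n} u *\<^sub>R f u) \<longlonglongrightarrow> f u"
  proof (rule AE_I2, rule tendsto_eventually)
    fix u :: real
    show "eventually (\<lambda>n. indicator {- real n..real n} u *\<^sub>R f u = f u) sequentially"
      using eventually_ge_at_top[of "nat \<lceil>\<bar>u\<bar>\<rceil>"]
    proof eventually_elim
      case (elim n)
      then have "u \<in> {- real n..real n}" by (simp, linarith)
      then show ?case by simp
    qed
  qed
  show "AE u in lborel. norm (indicator {- real n..real n} u *\<^sub>R f u) \<le> norm (f u)" for n
    by (intro AE_I2) (simp add: indicator_def)
qed (use borel_measurable_integrable[OF int] in measurable)

text \<open>A Stieltjes integral sees only increments, so \<open>\<mu>\<close> may be replaced by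
  \<open>\<mu> - \<kappa>\<close> before integrating by parts. The boundary terms at 0 cancel
  between the two half lines, and those at the far ends decay only because \<kappa> has been
  subtracted.\<close>

lemma laplace_stieltjes_eq_laplace_integral:
  assumes \<mu>: "determining_function \<mu>" and \<eta>: "\<eta> > 0"
    and g: "\<And>u. norm (\<mu> u - \<kappa>) \<le> C * exp (c * u - \<eta> * \<bar>u\<bar>)" and s: "Re s = c"
    and L: "has_laplace_stieltjes \<mu> s w"
  shows "w = s * (LINT u|lborel. exp (- s * of_real u) * (\<mu> u - \<kappa>))"
proof -
  note \<mu>' = determining_functionD[OF \<mu>]
  obtain J1 J2 w1 w2 where J:
    "\<And>R. R \<ge> 0 \<Longrightarrow> has_stieltjes_integral (\<lambda>t. exp (- s * of_real t)) \<mu> (J1 R) 0 R"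
    "\<And>R. R \<ge> 0 \<Longrightarrow> has_stieltjes_integral (\<lambda>t. exp (- s * of_real t)) \<mu> (J2 R) (- R) 0"
    "(J1 \<longlongrightarrow> w1) at_top" "(J2 \<longlongrightarrow> w2) at_top" "w = w1 + w2"
    using L unfolding has_laplace_stieltjes_def by blast
  let ?g = "\<lambda>u. \<mu> u - \<kappa>"
  let ?G = "\<lambda>u. exp (- s * of_real u) * ?g u"
  have [measurable]: "\<mu> \<in> borel_measurable borel" by (rule \<mu>'(3))
  have int: "integrable lborel ?G"
    by (rule exp_weight_integrable[OF g s _ \<eta>]) measurable
  have mid: "midpoint_normalized ?g"
    by (rule midpoint_normalized_diff_const[OF \<mu>'(1)])
  have bdd: "bounded (?g ` {A..B})" for A B
    using bounded_minus_comp[OF \<mu>'(4), of "\<lambda>_. \<kappa>" A B] by (auto simp: bounded_iff)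
  have shift: "has_stieltjes_integral f ?g I A B" if "has_stieltjes_integral f \<mu> I A B" for f I A B
    using that unfolding has_stieltjes_integral_def by simp
  have setint: "set_integrable lborel {A..B} ?G" for A B
    unfolding set_integrable_def by (rule integrable_mult_indicator[OF _ int]) simp
  have HK: "integral {A..B} ?G = (LINT u:{A..B}|lborel. ?G u)" for A B
    using set_borel_integral_eq_integral(2)[OF setint] by simp
  have eq: "J1 (real n) + J2 (real n) = ?G (real n) - ?G (- real n) + s * (LINT u:{- real n..real n}|lborel. ?G u)" for n
  proof -
    have "(?G integrable_on {- real n..real n})"
      using set_borel_integral_eq_integral(1)[OF setint] by simp
    then have comb: "integral {- real n..0} ?G + integral {0..real n} ?G = integral {- real n..real n} ?G"
      by (intro Henstock_Kurzweil_Integration.integral_combine) auto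
    have "J1 (real n) = ?G (real n) - ?G 0 + s * integral {0..real n} ?G"
      by (rule laplace_stieltjes_integral_by_parts[OF mid bdd shift[OF J(1)]]) auto
    moreover have "J2 (real n) = ?G 0 - ?G (- real n) + s * integral {- real n..0} ?G"
      by (rule laplace_stieltjes_integral_by_parts[OF mid bdd shift[OF J(2)]]) auto
    moreover have "x - y + i1 + (y - v + i2) = x - v + (i2 + i1)" for x y v i1 i2 :: complex
      by simp
    ultimately show ?thesis
      unfolding HK[symmetric] comb[symmetric] distrib_left by (simp only:)
  qed
  have lim0: "(\<lambda>n. C * exp (- \<eta> * real n)) \<longlonglongrightarrow> 0"
  proof -
    have "(\<lambda>n. C * exp (- \<eta> * real n)) \<longlonglongrightarrow> C * 0"
      by (intro tendsto_intros filterlim_compose[OF exp_at_bot]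
          filterlim_tendsto_neg_mult_at_bot[OF tendsto_const _ filterlim_real_sequentially]) (use \<eta> in auto)
    then show ?thesis by simp
  qed
  have G1: "(\<lambda>n. ?G (real n)) \<longlonglongrightarrow> 0"
    by (rule Lim_null_comparison[OF _ lim0], rule always_eventually, rule allI)
      (metis exp_weight_bound[OF g s] abs_of_nat)
  have G2: "(\<lambda>n. ?G (- real n)) \<longlonglongrightarrow> 0"
    by (rule Lim_null_comparison[OF _ lim0], rule always_eventually, rule allI)
      (metis exp_weight_bound[OF g s] abs_of_nat abs_minus_cancel)
  have I: "(\<lambda>n. LINT u:{- real n..real n}|lborel. ?G u) \<longlonglongrightarrow> (LINT u|lborel. ?G u)"
    by (rule tendsto_integral_symmetric_intervals[OF int])
  have "(\<lambda>n. J1 (real n) + J2 (real n)) \<longlonglongrightarrow> 0 - 0 + s * (LINT u|lborel. ?G u)"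
    unfolding eq by (intro tendsto_intros G1 G2 I)
  moreover have "(\<lambda>n. J1 (real n) + J2 (real n)) \<longlonglongrightarrow> w"
    unfolding J(5)
    by (intro tendsto_add filterlim_compose[OF J(3)] filterlim_compose[OF J(4)] filterlim_real_sequentially)
  ultimately show ?thesis
    using LIMSEQ_unique by fastforce
qed

section \<open>Inversion by Gaussian means\<close>

lemma Complex_measurable [measurable]: "Complex c \<in> borel_measurable borel"
  unfolding Complex_eq by measurable

text \<open>This is the bilateral Laplace transform of the centred normal density with standard
  deviation \<tau>. It is entire, so it creates no poles.\<close>

definition gauss_factor :: "real \<Rightarrow> complex \<Rightarrow> complex" where
  "gauss_factor \<tau> s = exp (of_real (\<tau>\<^sup>2 / 2) * s\<^sup>2)"

lemma norm_gauss_factor_line: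
  "norm (gauss_factor \<tau> (Complex c y)) = exp (\<tau>\<^sup>2 * c\<^sup>2 / 2) * exp (- (\<tau>\<^sup>2 * y\<^sup>2 / 2))"
  by (simp add: gauss_factor_def power2_eq_square algebra_simps diff_divide_distrib
      flip: exp_add)

lemma gauss_factor_line_measurable [measurable]:
  "(\<lambda>y. gauss_factor \<tau> (Complex c y)) \<in> borel_measurable borel"
  unfolding gauss_factor_def by measurable

lemma gaussian_integrable:
  assumes "\<tau> > 0"
  shows "integrable lborel (\<lambda>y::real. exp (- (\<tau>\<^sup>2 * y\<^sup>2 / 2)))"
proof -
  have "integrable lborel (\<lambda>y. sqrt (2 * pi) / \<tau> * normal_density 0 (1 / \<tau>) y)"
    using assms by (intro integrable_mult_right integrable_normal_density) auto
  also have "(\<lambda>y. sqrt (2 * pi) / \<tau> * normal_density 0 (1 / \<tau>) y) = (\<lambda>y. exp (- (\<tau>\<^sup>2 * y\<^sup>2 / 2)))"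
    using assms by (intro ext) (simp add: normal_density_def real_sqrt_mult real_sqrt_divide power_divide field_simps)
  finally show ?thesis .
qed

lemma gaussian_fourier_integral:
  "(LINT v|lborel. exp (\<i> * of_real (x * v)) * of_real (exp (- v\<^sup>2 / 2)))
    = of_real (sqrt (2 * pi) * exp (- x\<^sup>2 / 2))"
proof -
  have "(LINT v|lborel. std_normal_density v *\<^sub>R exp (\<i> * of_real (x * v))) = char std_normal_distribution x"
    unfolding char_def by (subst integral_density) auto
  also have "\<dots> = of_real (exp (- x\<^sup>2 / 2))"
    by (simp add: char_std_normal_distribution)
  finally have 1: "(LINT v|lborel. std_normal_density v *\<^sub>R exp (\<i> * of_real (x * v))) = of_real (exp (- x\<^sup>2 / 2))" .
  have "(LINT v|lborel. exp (\<i> * of_real (x * v)) * of_real (exp (- v\<^sup>2 / 2)))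
      = (LINT v|lborel. of_real (sqrt (2 * pi)) * (std_normal_density v *\<^sub>R exp (\<i> * of_real (x * v))))"
    by (intro Bochner_Integration.integral_cong refl)
      (simp add: std_normal_density_def scaleR_conv_of_real mult_ac)
  also have "\<dots> = of_real (sqrt (2 * pi) * exp (- x\<^sup>2 / 2))"
    unfolding integral_mult_right_zero 1 by simp
  finally show ?thesis .
qed

lemma gaussian_line_integral:
  assumes "\<tau> > 0"
  shows "(LINT y|lborel. exp (Complex c y * of_real x) * gauss_factor \<tau> (Complex c y))
    = of_real (2 * pi * normal_density 0 \<tau> x)"
proof -
  \<comment> \<open>After the substitution \<open>y = v / \<tau>\<close> the exponent is a constant,
    collected in \<open>A\<close>, plus \<open>\<i> * x' * v - v\<^sup>2 / 2\<close>. In the end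
    \<open>A * exp (- x'\<^sup>2 / 2)\<close> no longer depends on \<open>c\<close>: all vertical
    lines give the same density.\<close>
  define x' where "x' = x / \<tau> + \<tau> * c"
  define A where "A = exp (c * x + \<tau>\<^sup>2 * c\<^sup>2 / 2)"
  have "(LINT y|lborel. exp (Complex c y * of_real x) * gauss_factor \<tau> (Complex c y))
      = \<bar>1 / \<tau>\<bar> *\<^sub>R (LINT v|lborel. exp (Complex c (0 + 1 / \<tau> * v) * of_real x) * gauss_factor \<tau> (Complex c (0 + 1 / \<tau> * v)))"
    by (rule lborel_integral_real_affine) (use assms in auto)
  also have "(LINT v|lborel. exp (Complex c (0 + 1 / \<tau> * v) * of_real x) * gauss_factor \<tau> (Complex c (0 + 1 / \<tau> * v)))
      = (LINT v|lborel. of_real A * (exp (\<i> * of_real (x' * v)) * of_real (exp (- v\<^sup>2 / 2))))"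
  proof (intro Bochner_Integration.integral_cong refl)
    fix v :: real
    have "Complex c (0 + 1 / \<tau> * v) * of_real x + of_real (\<tau>\<^sup>2 / 2) * (Complex c (0 + 1 / \<tau> * v))\<^sup>2
        = of_real (c * x + \<tau>\<^sup>2 * c\<^sup>2 / 2) + (\<i> * of_real (x' * v) + of_real (- v\<^sup>2 / 2))"
      using assms unfolding x'_def
      by (simp add: complex_eq_iff power2_eq_square field_simps)
    then show "exp (Complex c (0 + 1 / \<tau> * v) * of_real x) * gauss_factor \<tau> (Complex c (0 + 1 / \<tau> * v))
        = of_real A * (exp (\<i> * of_real (x' * v)) * of_real (exp (- v\<^sup>2 / 2)))"
      unfolding gauss_factor_def A_def exp_of_real[symmetric] exp_add[symmetric] by simp
  qed
  also have "\<dots> = of_real A * of_real (sqrt (2 * pi) * exp (- x'\<^sup>2 / 2))"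
    by (simp only: integral_mult_right_zero gaussian_fourier_integral)
  also have "\<bar>1 / \<tau>\<bar> *\<^sub>R \<dots> = of_real (sqrt (2 * pi) / \<tau> * (A * exp (- x'\<^sup>2 / 2)))"
    using assms by (simp add: scaleR_conv_of_real)
  also have "A * exp (- x'\<^sup>2 / 2) = exp (- x\<^sup>2 / (2 * \<tau>\<^sup>2))"
    using assms unfolding A_def x'_def exp_add[symmetric] by (simp add: power2_eq_square field_simps)
  also have "sqrt (2 * pi) / \<tau> * exp (- x\<^sup>2 / (2 * \<tau>\<^sup>2)) = 2 * pi * normal_density 0 \<tau> x"
    using assms by (simp add: normal_density_def real_sqrt_mult field_simps flip: power2_eq_square)
  finally show ?thesis .
qed

text \<open>Without the Gaussian the double integral would not converge absolutely. With it, the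
  norm of the kernel splits into a Gaussian in \<open>y\<close> times an integrable weight in
  \<open>u\<close>, since \<open>norm (exp (- s * u))\<close> depends only on \<open>Re s\<close>.
  Fubini then leaves the Gaussian line integral inside.\<close>

lemma gaussian_inversion:
  fixes g :: "real \<Rightarrow> complex"
  assumes g: "\<And>u. norm (g u) \<le> C * exp (c * u - \<eta> * \<bar>u\<bar>)"
    and meas: "g \<in> borel_measurable borel" and \<eta>: "\<eta> > 0" and \<tau>: "\<tau> > 0"
  defines "G \<equiv> \<lambda>s. LINT u|lborel. exp (- s * of_real u) * g u"
  shows "(LINT y|lborel. exp (Complex c y * of_real t) * G (Complex c y) * gauss_factor \<tau> (Complex c y))
    = 2 * pi * (LINT u|lborel. g u * of_real (normal_density 0 \<tau> (t - u)))"
proof -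
  let ?s = "Complex c"
  let ?k = "\<lambda>y u. exp (?s y * of_real t) * (exp (- ?s y * of_real u) * g u) * gauss_factor \<tau> (?s y)"
  note [measurable] = meas
  define w where "w u = norm (exp (- of_real c * of_real u) * g u)" for u
  define A where "A y = exp (c * t) * (exp (\<tau>\<^sup>2 * c\<^sup>2 / 2) * exp (- (\<tau>\<^sup>2 * y\<^sup>2 / 2)))" for y :: real
  have norm_k: "norm (?k y u) = A y * w u" for y u
    by (simp add: norm_mult A_def w_def norm_gauss_factor_line)
  have w: "integrable lborel w"
    unfolding w_def using exp_weight_integrable[OF g _ meas \<eta>, of "of_real c"] by simp
  have A: "integrable lborel A"
    unfolding A_def using gaussian_integrable[OF \<tau>] by simp
  have kint: "integrable lborel (\<lambda>u. ?k y u)" for y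
    using exp_weight_integrable[OF g _ meas \<eta>, of "?s y"] by simp
  have int: "integrable (lborel \<Otimes>\<^sub>M lborel) (case_prod ?k)"
  proof (rule lborel_pair.Fubini_integrable)
    show "case_prod ?k \<in> borel_measurable (lborel \<Otimes>\<^sub>M lborel)" by measurable
    show "integrable lborel (\<lambda>y. LINT u|lborel. norm (case_prod ?k (y, u)))"
      unfolding prod.case norm_k integral_mult_right_zero by (rule integrable_mult_left, rule A)
    show "AE y in lborel. integrable lborel (\<lambda>u. case_prod ?k (y, u))"
      using kint by simp
  qed
  have "(LINT y|lborel. exp (?s y * of_real t) * G (?s y) * gauss_factor \<tau> (?s y))
      = (LINT y|lborel. LINT u|lborel. ?k y u)"
    unfolding G_def by (simp only: integral_mult_right_zero integral_mult_left_zero)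
  also have "\<dots> = (LINT u|lborel. LINT y|lborel. ?k y u)"
    by (rule lborel_pair.Fubini_integral[OF int, symmetric])
  also have "\<dots> = (LINT u|lborel. g u * of_real (2 * pi * normal_density 0 \<tau> (t - u)))"
  proof (intro Bochner_Integration.integral_cong refl)
    fix u :: real
    have "?k y u = g u * (exp (?s y * of_real (t - u)) * gauss_factor \<tau> (?s y))" for y
      by (simp add: algebra_simps flip: exp_add)
    then show "(LINT y|lborel. ?k y u) = g u * of_real (2 * pi * normal_density 0 \<tau> (t - u))"
      by (simp only: integral_mult_right_zero gaussian_line_integral[OF \<tau>])
  qed
  also have "\<dots> = (LINT u|lborel. (2 * pi) * (g u * of_real (normal_density 0 \<tau> (t - u))))"
    by (intro Bochner_Integration.integral_cong refl) simp
  finally show ?thesis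
    by (simp only: integral_mult_right_zero)
qed

text \<open>Completing the square turns \<open>exp (a * v)\<close> times the standard density into a
  multiple of a shifted normal density; the cases \<open>a = c\<close> and \<open>a = - c\<close>
  together dominate.\<close>

lemma exp_times_gaussian_integrable:
  "integrable lborel (\<lambda>v. exp (c * \<bar>v\<bar>) * std_normal_density v)"
proof -
  have eq: "exp (a * v) * std_normal_density v = exp (a\<^sup>2 / 2) * normal_density a 1 v" for a v :: real
    by (simp add: normal_density_def power2_eq_square field_simps flip: exp_add)
  have "integrable lborel (\<lambda>v. exp (a * v) * std_normal_density v)" for a
    unfolding eq by (intro integrable_mult_right integrable_normal_density) auto
  from Bochner_Integration.integrable_add[OF this[of c] this[of "- c"]] show ?thesis
  proof (rule Bochner_Integration.integrable_bound)
    have "exp (c * \<bar>v\<bar>) \<le> exp (c * v) + exp (- c * v)" for v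
      by (cases "v \<ge> 0") auto
    then have "exp (c * \<bar>v\<bar>) * std_normal_density v
        \<le> exp (c * v) * std_normal_density v + exp (- c * v) * std_normal_density v" for v
      using mult_right_mono[of _ _ "std_normal_density v"] by (fastforce simp flip: distrib_right)
    then show "AE v in lborel. norm (exp (c * \<bar>v\<bar>) * std_normal_density v)
        \<le> norm (exp (c * v) * std_normal_density v + exp (- c * v) * std_normal_density v)"
      by (intro AE_I2) (simp add: order_trans[OF _ abs_ge_self])
  qed measurable
qed

text \<open>
  Since the kernel is even, averaging over \<open>v\<close> and \<open>-v\<close> brings both one-sided limits into play
  symmetrically, so the limit is the normalized value even at a jump.
\<close>
lemma gaussian_average_tendsto:
  fixes g :: "real \<Rightarrow> complex"
  assumes mid: "midpoint_normalized g" and g: "\<And>u. norm (g u) \<le> C * exp (c * \<bar>u\<bar>)" and c: "c \<ge> 0"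
    and \<tau>: "\<And>n. \<tau> n > 0" "\<And>n. \<tau> n \<le> 1" "\<tau> \<longlonglongrightarrow> 0"
  shows "(\<lambda>n. LINT u|lborel. g u * of_real (normal_density 0 (\<tau> n) (t - u))) \<longlonglongrightarrow> g t"
proof -
  have [measurable]: "g \<in> borel_measurable borel"
    by (rule midpoint_normalized_measurable[OF mid])
  have "0 \<le> C * exp (c * \<bar>0\<bar>)" by (rule order_trans[OF norm_ge_zero g])
  then have C: "C \<ge> 0" by simp
  let ?N = std_normal_density
  let ?w = "\<lambda>v. C * exp (c * \<bar>t\<bar>) * (exp (c * \<bar>v\<bar>) * ?N v)"
  have w: "integrable lborel ?w"
    by (intro integrable_mult_right exp_times_gaussian_integrable)
  have bnd: "norm (g (t + a * v) * of_real (?N v)) \<le> ?w v" if "\<bar>a\<bar> \<le> 1" for a v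
  proof -
    have "\<bar>t + a * v\<bar> \<le> \<bar>t\<bar> + \<bar>a\<bar> * \<bar>v\<bar>"
      by (simp add: abs_mult order_trans[OF abs_triangle_ineq])
    also have "\<dots> \<le> \<bar>t\<bar> + \<bar>v\<bar>"
      using mult_right_mono[OF that, of "\<bar>v\<bar>"] by simp
    finally have "c * \<bar>t + a * v\<bar> \<le> c * (\<bar>t\<bar> + \<bar>v\<bar>)"
      using c by (rule mult_left_mono)
    then have "exp (c * \<bar>t + a * v\<bar>) \<le> exp (c * \<bar>t\<bar>) * exp (c * \<bar>v\<bar>)"
      by (simp add: distrib_left flip: exp_add)
    then have "norm (g (t + a * v)) \<le> C * (exp (c * \<bar>t\<bar>) * exp (c * \<bar>v\<bar>))"
      using g[of "t + a * v"] C by (meson mult_left_mono order_trans)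
    then have "norm (g (t + a * v)) * ?N v \<le> C * (exp (c * \<bar>t\<bar>) * exp (c * \<bar>v\<bar>)) * ?N v"
      by (rule mult_right_mono) simp
    then show ?thesis by (simp add: norm_mult mult.assoc)
  qed
  have int: "integrable lborel (\<lambda>v. g (t + a * v) * of_real (?N v))" if "\<bar>a\<bar> \<le> 1" for a
  proof (rule Bochner_Integration.integrable_bound[OF w])
    show "AE v in lborel. norm (g (t + a * v) * of_real (?N v)) \<le> norm (?w v)"
      using bnd[OF that] by (intro AE_I2) (metis abs_ge_self order_trans real_norm_def)
  qed measurable
  \<comment> \<open>The scale \<open>a\<close> may be negative while the density sees only its
    absolute value, so \<open>a\<close> and \<open>- a\<close> give two expressions for one and the
    same integral; \<open>avg\<close> is their mean.\<close>
  have sub: "(LINT u|lborel. g u * of_real (normal_density 0 \<bar>a\<bar> (t - u)))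
      = (LINT v|lborel. g (t + a * v) * of_real (?N v))" if "a \<noteq> 0" for a
  proof -
    have "(LINT u|lborel. g u * of_real (normal_density 0 \<bar>a\<bar> (t - u)))
        = \<bar>a\<bar> *\<^sub>R (LINT v|lborel. g (t + a * v) * of_real (normal_density 0 \<bar>a\<bar> (t - (t + a * v))))"
      by (rule lborel_integral_real_affine[OF that])
    also have "\<dots> = (LINT v|lborel. \<bar>a\<bar> *\<^sub>R (g (t + a * v) * of_real (normal_density 0 \<bar>a\<bar> (t - (t + a * v)))))"
      by (rule integral_scaleR_right[symmetric])
    also have "\<dots> = (LINT v|lborel. g (t + a * v) * of_real (?N v))"
    proof (intro Bochner_Integration.integral_cong refl)
      fix v :: real
      have "\<bar>a\<bar> * normal_density 0 \<bar>a\<bar> (t - (t + a * v)) = ?N v"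
        using that by (simp add: normal_density_def real_sqrt_mult power_mult_distrib field_simps)
      then show "\<bar>a\<bar> *\<^sub>R (g (t + a * v) * of_real (normal_density 0 \<bar>a\<bar> (t - (t + a * v))))
          = g (t + a * v) * of_real (?N v)"
        by (simp add: scaleR_conv_of_real flip: of_real_mult)
    qed
    finally show ?thesis .
  qed
  let ?h = "\<lambda>n v. (g (t + \<tau> n * v) + g (t + (- \<tau> n) * v)) / 2 * of_real (?N v)"
  have avg: "(LINT u|lborel. g u * of_real (normal_density 0 (\<tau> n) (t - u))) = (LINT v|lborel. ?h n v)" for n
  proof -
    let ?I = "LINT u|lborel. g u * of_real (normal_density 0 (\<tau> n) (t - u))"
    have 1: "?I = (LINT v|lborel. g (t + \<tau> n * v) * of_real (?N v))"
      using sub[of "\<tau> n"] \<tau>(1)[of n] by simp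
    have 2: "?I = (LINT v|lborel. g (t + (- \<tau> n) * v) * of_real (?N v))"
      using sub[of "- \<tau> n"] \<tau>(1)[of n] by simp
    have "(LINT v|lborel. ?h n v)
        = (LINT v|lborel. (g (t + \<tau> n * v) * of_real (?N v) + g (t + (- \<tau> n) * v) * of_real (?N v)) / 2)"
      by (intro Bochner_Integration.integral_cong refl) (simp add: field_simps)
    also have "\<dots> = ((LINT v|lborel. g (t + \<tau> n * v) * of_real (?N v))
        + (LINT v|lborel. g (t + (- \<tau> n) * v) * of_real (?N v))) / 2"
      using int[of "\<tau> n"] int[of "- \<tau> n"] \<tau>(1,2)[of n]
      by (subst integral_divide_zero, subst Bochner_Integration.integral_add) auto
    finally show ?thesis
      using 1 2 by simp
  qed
  have lim: "(\<lambda>n. ?h n v) \<longlonglongrightarrow> g t * of_real (?N v)" for v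
  proof -
    obtain u u' where u: "(g \<longlongrightarrow> u) (at_right t)" "(g \<longlongrightarrow> u') (at_left t)" "g t = (u + u') / 2"
      using mid unfolding midpoint_normalized_def by blast
    have R: "(\<lambda>n. g (t + \<tau> n * v)) \<longlonglongrightarrow> u" if "v > 0" for v
    proof (rule filterlim_compose[OF u(1)])
      have "(\<lambda>n. t + \<tau> n * v) \<longlonglongrightarrow> t + 0 * v"
        by (intro tendsto_intros \<tau>(3))
      then show "filterlim (\<lambda>n. t + \<tau> n * v) (at_right t) sequentially"
        using that less_imp_neq[OF \<tau>(1)] \<tau>(1) by (auto simp: filterlim_at intro!: always_eventually)
    qed
    have L: "(\<lambda>n. g (t + (- \<tau> n) * v)) \<longlonglongrightarrow> u'" if "v > 0" for v
    proof (rule filterlim_compose[OF u(2)])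
      have "(\<lambda>n. t + (- \<tau> n) * v) \<longlonglongrightarrow> t + (- 0) * v"
        by (intro tendsto_intros \<tau>(3))
      then show "filterlim (\<lambda>n. t + (- \<tau> n) * v) (at_left t) sequentially"
        using that less_imp_neq[OF \<tau>(1)] \<tau>(1) by (auto simp: filterlim_at intro!: always_eventually)
    qed
    \<comment> \<open>For \<open>v < 0\<close> the two one-sided limits exchange roles, and for
      \<open>v = 0\<close> the sequence is constantly \<open>2 * g t\<close>.\<close>
    have "(\<lambda>n. g (t + \<tau> n * v) + g (t + (- \<tau> n) * v)) \<longlonglongrightarrow> g t * 2"
    proof (cases v "0::real" rule: linorder_cases)
      case less
      then show ?thesis
        using tendsto_add[OF L[of "- v"] R[of "- v"]] u(3) by (simp add: add.commute)
    next
      case greater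
      then show ?thesis
        using tendsto_add[OF R[of v] L[of v]] u(3) by simp
    qed (simp add: mult.commute)
    then have "(\<lambda>n. ?h n v) \<longlonglongrightarrow> g t * 2 / 2 * of_real (?N v)"
      by (intro tendsto_intros) auto
    then show ?thesis by simp
  qed
  have "(\<lambda>n. LINT v|lborel. ?h n v) \<longlonglongrightarrow> (LINT v|lborel. g t * of_real (?N v))"
  proof (rule integral_dominated_convergence[OF _ _ w])
    show "AE v in lborel. norm (?h n v) \<le> ?w v" for n
    proof (rule AE_I2)
      fix v
      have "norm (?h n v) = norm (g (t + \<tau> n * v) * of_real (?N v) + g (t + (- \<tau> n) * v) * of_real (?N v)) / 2"
        by (simp add: norm_mult norm_divide flip: distrib_right)
      also have "\<dots> \<le> (?w v + ?w v) / 2"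
        using \<tau>(1,2)[of n] by (intro divide_right_mono norm_triangle_mono bnd) auto
      also have "\<dots> = ?w v" by (rule field_sum_of_halves[folded add_divide_distrib])
      finally show "norm (?h n v) \<le> ?w v" .
    qed
    show "AE v in lborel. (\<lambda>n. ?h n v) \<longlonglongrightarrow> g t * of_real (?N v)"
      using lim by simp
  qed measurable
  also have "(LINT v|lborel. g t * of_real (?N v)) = g t * of_real (LINT v|lborel. ?N v)"
    by (simp only: integral_mult_right_zero integral_complex_of_real)
  finally show ?thesis
    unfolding avg by simp
qed

text \<open>On the line \<open>G\<close> is bounded by the integral of the weighted norm of
  \<open>g\<close>; integrability in \<open>y\<close> comes from the Gaussian alone.\<close>

lemma laplace_line_integrable:
  fixes g :: "real \<Rightarrow> complex"
  assumes g: "\<And>u. norm (g u) \<le> C * exp (c * u - \<eta> * \<bar>u\<bar>)"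
    and meas: "g \<in> borel_measurable borel" and \<eta>: "\<eta> > 0" and \<tau>: "\<tau> > 0"
  defines "G \<equiv> \<lambda>s. LINT u|lborel. exp (- s * of_real u) * g u"
  shows "integrable lborel (\<lambda>y. exp (Complex c y * of_real t) * G (Complex c y) * gauss_factor \<tau> (Complex c y))"
proof (rule Bochner_Integration.integrable_bound)
  note [measurable] = meas
  define M where "M = (LINT u|lborel. norm (exp (- of_real c * of_real u) * g u))"
  let ?w = "\<lambda>y. exp (c * t) * M * exp (\<tau>\<^sup>2 * c\<^sup>2 / 2) * exp (- (\<tau>\<^sup>2 * y\<^sup>2 / 2))"
  show "integrable lborel ?w"
    using gaussian_integrable[OF \<tau>] by simp
  show "(\<lambda>y. exp (Complex c y * of_real t) * G (Complex c y) * gauss_factor \<tau> (Complex c y)) \<in> borel_measurable lborel"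
    unfolding G_def by measurable
  show "AE y in lborel. norm (exp (Complex c y * of_real t) * G (Complex c y) * gauss_factor \<tau> (Complex c y)) \<le> norm (?w y)"
  proof (rule AE_I2)
    fix y
    have "norm (G (Complex c y)) \<le> M"
      unfolding G_def M_def
      by (rule order_trans[OF integral_norm_bound]) (simp add: norm_mult)
    then have "norm (exp (Complex c y * of_real t) * G (Complex c y) * gauss_factor \<tau> (Complex c y))
        \<le> exp (c * t) * M * (exp (\<tau>\<^sup>2 * c\<^sup>2 / 2) * exp (- (\<tau>\<^sup>2 * y\<^sup>2 / 2)))"
      unfolding norm_mult norm_gauss_factor_line by (intro mult_right_mono mult_mono) auto
    also have "\<dots> = ?w y" by (simp only: mult.assoc)
    also have "\<dots> \<le> norm (?w y)" by simp
    finally show "norm (exp (Complex c y * of_real t) * G (Complex c y) * gauss_factor \<tau> (Complex c y)) \<le> norm (?w y)" .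
  qed
qed

text \<open>The singularity at 0 is filled with its limit \<open>t\<close>, so the function is
  entire and the origin is singular for the integrand only if \<open>F\<close> is singular
  there.\<close>

definition exp_quotient :: "real \<Rightarrow> complex \<Rightarrow> complex" where
  "exp_quotient t s = (if s = 0 then of_real t else (exp (s * of_real t) - 1) / s)"

text \<open>Off the origin the integrand is the inversion kernel for \<open>t\<close> minus that for
  0, so the limits combine to \<open>g t - g 0\<close>. The unknown \<kappa> drops out and
  \<open>\<mu> 0 = 0\<close> leaves \<open>\<mu> t\<close>. The sign condition on
  \<open>\<sigma>1 * \<sigma>2\<close> keeps the line away from the origin, where division by
  \<open>s\<close> would fail.\<close>

lemma laplace_stieltjes_line_inversion:
  fixes h :: "nat \<Rightarrow> real \<Rightarrow> complex" and F :: "complex \<Rightarrow> complex"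
    and \<mu> :: "real \<Rightarrow> complex" and t :: real
  assumes \<mu>: "determining_function \<mu>" and \<sigma>: "\<sigma>1 < c" "c < \<sigma>2" "\<sigma>1 * \<sigma>2 > 0"
    and F: "\<And>s. Re s \<in> {\<sigma>1..\<sigma>2} \<Longrightarrow> has_laplace_stieltjes \<mu> s (F s)"
    and \<tau>: "\<And>n. \<tau> n > 0" "\<And>n. \<tau> n \<le> 1" "\<tau> \<longlonglongrightarrow> 0"
  defines "h \<equiv> \<lambda>n y. exp_quotient t (Complex c y) * F (Complex c y) * gauss_factor (\<tau> n) (Complex c y)"
  shows "integrable lborel (h n)" "(\<lambda>n. LINT y|lborel. h n y) \<longlonglongrightarrow> 2 * pi * \<mu> t"
proof -
  note \<mu>' = determining_functionD[OF \<mu>]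
  have L: "has_laplace_stieltjes \<mu> (of_real \<sigma>1) (F (of_real \<sigma>1))"
      "has_laplace_stieltjes \<mu> (of_real \<sigma>2) (F (of_real \<sigma>2))"
    using \<sigma>(1,2) by (intro F, simp)+
  obtain \<kappa> C where \<kappa>: "\<And>t. norm (\<mu> t - \<kappa>) \<le> C * exp (\<sigma>1 * t)" "\<And>t. norm (\<mu> t - \<kappa>) \<le> C * exp (\<sigma>2 * t)"
    by (rule laplace_stieltjes_growth2[OF \<mu> L \<sigma>(3)]) (rule that)
  have "0 \<le> C * exp (\<sigma>1 * 0)"
    by (rule order_trans[OF norm_ge_zero \<kappa>(1)])
  then have C: "C \<ge> 0" by simp
  define \<eta> where "\<eta> = min (c - \<sigma>1) (\<sigma>2 - c)"
  have \<eta>: "\<eta> > 0" using \<sigma> by (simp add: \<eta>_def)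
  define g where "g u = \<mu> u - \<kappa>" for u
  have g: "norm (g u) \<le> C * exp (c * u - \<eta> * \<bar>u\<bar>)" for u
    unfolding g_def \<eta>_def by (rule min_exp_le[OF \<kappa> C \<sigma>(1,2)])
  have [measurable]: "g \<in> borel_measurable borel"
    unfolding g_def using \<mu>'(3) by measurable
  have c0: "c \<noteq> 0" using \<sigma> by (auto simp: zero_less_mult_iff)
  define G where "G s = (LINT u|lborel. exp (- s * of_real u) * g u)" for s
  have FG: "F s = s * G s" if "Re s = c" for s
    unfolding G_def g_def
    by (rule laplace_stieltjes_eq_laplace_integral[OF \<mu> \<eta> g[unfolded g_def] that F]) (use that \<sigma> in auto)
  define k where "k n t y = exp (Complex c y * of_real t) * G (Complex c y) * gauss_factor (\<tau> n) (Complex c y)" for n t y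
  have hk: "h n y = k n t y - k n 0 y" for n y
  proof -
    have "Complex c y \<noteq> 0" using c0 by (metis complex.sel(1) zero_complex.sel(1))
    then show ?thesis
      unfolding h_def k_def exp_quotient_def by (simp add: FG field_simps)
  qed
  have kint: "integrable lborel (k n t)" for n t
    unfolding k_def G_def by (rule laplace_line_integrable[OF g _ \<eta> \<tau>(1)]) measurable
  show "integrable lborel (h n)"
    unfolding hk[abs_def] by (intro Bochner_Integration.integrable_diff kint)
  have midg: "midpoint_normalized g"
    unfolding g_def by (rule midpoint_normalized_diff_const[OF \<mu>'(1)])
  have g': "norm (g u) \<le> C * exp (\<bar>c\<bar> * \<bar>u\<bar>)" for u
  proof (rule order_trans[OF g])
    have "c * u \<le> \<bar>c\<bar> * \<bar>u\<bar>" by (metis abs_ge_self abs_mult)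
    moreover have "0 \<le> \<eta> * \<bar>u\<bar>" using \<eta> by simp
    ultimately show "C * exp (c * u - \<eta> * \<bar>u\<bar>) \<le> C * exp (\<bar>c\<bar> * \<bar>u\<bar>)"
      using C by (intro mult_left_mono) auto
  qed
  have klim: "(\<lambda>n. LINT y|lborel. k n t y) \<longlonglongrightarrow> 2 * pi * g t" for t
    unfolding k_def G_def gaussian_inversion[OF g \<open>g \<in> borel_measurable borel\<close> \<eta> \<tau>(1)]
    by (intro tendsto_mult tendsto_const gaussian_average_tendsto[OF midg g' _ \<tau>]) simp
  have "(\<lambda>n. LINT y|lborel. h n y) \<longlonglongrightarrow> 2 * pi * g t - 2 * pi * g 0"
    unfolding hk Bochner_Integration.integral_diff[OF kint kint]
    by (intro tendsto_diff klim)
  also have "2 * pi * g t - 2 * pi * g 0 = 2 * pi * \<mu> t"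
    by (simp add: g_def \<mu>'(2) algebra_simps)
  finally show "(\<lambda>n. LINT y|lborel. h n y) \<longlonglongrightarrow> 2 * pi * \<mu> t" .
qed

section \<open>Shift of contour\<close>

lemma connected_open_vertical_strip: "connected {s. a < Re s \<and> Re s < b}" "open {s. a < Re s \<and> Re s < b}"
proof -
  have eq: "{s. a < Re s \<and> Re s < b} = {s. a < Re s} \<inter> {s. Re s < b}" by auto
  show "connected {s. a < Re s \<and> Re s < b}"
    unfolding eq by (intro convex_connected convex_Int convex_halfspace_Re_gt convex_halfspace_Re_lt)
  show "open {s. a < Re s \<and> Re s < b}"
    unfolding eq by (intro open_Int open_halfspace_Re_gt open_halfspace_Re_lt)
qed

text \<open>The residue theorem is applied to rectangles of height \<open>2 * T\<close>. The poles
  lie strictly between the two lines and, for large \<open>T\<close>, below the horizontal sides,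
  whose contributions \<open>D\<close> sends to 0. The factor is \<open>2 * pi\<close> instead of
  \<open>2 * pi * \<i>\<close> because the lines are parametrized by \<open>y\<close> with
  \<open>ds = \<i> dy\<close>.\<close>

lemma strip_contour_shift:
  fixes H :: "complex \<Rightarrow> complex"
  assumes c: "a < c1" "c1 < c2" "c2 < b"
    and S: "finite S" "\<And>p. p \<in> S \<Longrightarrow> c1 < Re p \<and> Re p < c2"
    and holo: "H holomorphic_on {s. a < Re s \<and> Re s < b} - S"
    and int: "integrable lborel (\<lambda>y. H (Complex c1 y))" "integrable lborel (\<lambda>y. H (Complex c2 y))"
    and decay: "\<And>x y. c1 \<le> x \<Longrightarrow> x \<le> c2 \<Longrightarrow> Y \<le> \<bar>y\<bar> \<Longrightarrow> norm (H (Complex x y)) \<le> D \<bar>y\<bar>"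
    and D: "(D \<longlongrightarrow> 0) at_top"
  shows "(LINT y|lborel. H (Complex c2 y)) - (LINT y|lborel. H (Complex c1 y))
    = 2 * pi * (\<Sum>p\<in>S. residue H p)"
proof -
  let ?U = "{s. a < Re s \<and> Re s < b}"
  let ?R = "\<Sum>p\<in>S. residue H p"
  define I where "I c T = (LINT y:{-T..T}|lborel. H (Complex c y))" for c T
  obtain Y0 where Y0: "\<And>p. p \<in> S \<Longrightarrow> \<bar>Im p\<bar> < Y0"
  proof -
    have "bdd_above ((\<lambda>p. \<bar>Im p\<bar>) ` S)" using S(1) by simp
    then obtain B where B: "\<forall>x\<in>(\<lambda>p. \<bar>Im p\<bar>) ` S. x \<le> B"
      unfolding bdd_above_def by blast
    have "\<bar>Im p\<bar> < B + 1" if "p \<in> S" for p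
      using B that by fastforce
    then show ?thesis by (rule that)
  qed
  have main: "norm (\<i> * I c2 T - \<i> * I c1 T - 2 * pi * \<i> * ?R) \<le> 2 * (c2 - c1) * D T"
    if T: "T \<ge> Y" "T > Y0" "T > 0" for T
  proof -
    let ?p1 = "Complex c1 (-T)" and ?p2 = "Complex c2 (-T)" and ?p3 = "Complex c2 T" and ?p4 = "Complex c1 T"
    let ?g = "rectpath ?p1 ?p3"
    have sub: "path_image ?g \<subseteq> ?U - S"
    proof
      fix z assume "z \<in> path_image ?g"
      then have "z \<in> {z. Re z \<in> {c1, c2} \<and> Im z \<in> {-T..T}} \<union> {z. Im z \<in> {-T, T} \<and> Re z \<in> {c1..c2}}"
        using path_image_rectpath[of ?p1 ?p3] c T by auto
      then show "z \<in> ?U - S"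
        using c S(2)[of z] Y0[of z] T by auto
    qed
    have segs: "closed_segment ?p1 ?p2 \<subseteq> path_image ?g" "closed_segment ?p2 ?p3 \<subseteq> path_image ?g"
        "closed_segment ?p3 ?p4 \<subseteq> path_image ?g" "closed_segment ?p4 ?p1 \<subseteq> path_image ?g"
      by (auto simp: rectpath_def Let_def path_image_join)
    have ci: "H contour_integrable_on linepath u v" if "closed_segment u v \<subseteq> path_image ?g" for u v
      by (intro contour_integrable_continuous_linepath holomorphic_on_imp_continuous_on
          holomorphic_on_subset[OF holo] subset_trans[OF that sub])
    note cis = ci[OF segs(1)] ci[OF segs(2)] ci[OF segs(3)] ci[OF segs(4)]
    have "contour_integral ?g H = 2 * pi * \<i> * (\<Sum>p\<in>S. winding_number ?g p * residue H p)"
    proof (rule Residue_theorem[OF connected_open_vertical_strip(2,1) S(1) holo])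
      show "\<forall>z. z \<notin> ?U \<longrightarrow> winding_number ?g z = 0"
      proof (intro allI impI winding_number_rectpath_outside)
        fix z assume "z \<notin> ?U"
        then show "z \<notin> cbox ?p1 ?p3"
          using c by (auto simp: in_cbox_complex_iff)
      qed (use c T in auto)
    qed (use sub in auto)
    also have "(\<Sum>p\<in>S. winding_number ?g p * residue H p) = ?R"
    proof (intro sum.cong refl)
      fix p assume p: "p \<in> S"
      have "winding_number ?g p = 1"
        by (rule winding_number_rectpath) (use S(2)[OF p] Y0[OF p] T in \<open>auto simp: in_box_complex_iff\<close>)
      then show "winding_number ?g p * residue H p = residue H p" by simp
    qed
    finally have res: "contour_integral ?g H = 2 * pi * \<i> * ?R" .
    have "contour_integral ?g H = contour_integral (linepath ?p1 ?p2) H + contour_integral (linepath ?p2 ?p3) H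
        + contour_integral (linepath ?p3 ?p4) H + contour_integral (linepath ?p4 ?p1) H"
      using cis by (simp add: rectpath_def Let_def contour_integrable_join)
    moreover have "contour_integral (linepath ?p2 ?p3) H = \<i> * I c2 T"
    proof -
      have "integral {-T..T} (\<lambda>y. H (Complex c2 y)) = I c2 T"
        unfolding I_def by (intro set_borel_integral_eq_integral(2)[symmetric])
          (simp add: set_integrable_def integrable_mult_indicator[OF _ int(2)])
      then show ?thesis
        using T by (subst contour_integral_linepath_same_Re[of _ c2 _ "-T" T]) auto
    qed
    moreover have "contour_integral (linepath ?p4 ?p1) H = - \<i> * I c1 T"
    proof -
      have "integral {-T..T} (\<lambda>y. H (Complex c1 y)) = I c1 T"
        unfolding I_def by (intro set_borel_integral_eq_integral(2)[symmetric])
          (simp add: set_integrable_def integrable_mult_indicator[OF _ int(1)])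
      moreover have "contour_integral (linepath ?p4 ?p1) H = - contour_integral (linepath ?p1 ?p4) H"
        using contour_integral_reversepath[of "linepath ?p1 ?p4" H] by simp
      ultimately show ?thesis
        using T by (subst (asm) contour_integral_linepath_same_Re[of _ c1 _ "-T" T]) auto
    qed
    \<comment> \<open>The unordered pair \<open>{u, v}\<close> covers both horizontal sides, which
      are traversed in opposite directions.\<close>
    moreover have hor: "norm (contour_integral (linepath (Complex u y) (Complex v y)) H) \<le> D T * (c2 - c1)"
      if uv: "{u, v} = {c1, c2}" "\<bar>y\<bar> = T" "H contour_integrable_on linepath (Complex u y) (Complex v y)" for u v y
    proof -
      have "norm (contour_integral (linepath (Complex u y) (Complex v y)) H) \<le> D T * norm (Complex v y - Complex u y)"
      proof (rule contour_integral_bound_linepath[OF uv(3)])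
        show "0 \<le> D T"
          using decay[of c1 y] c uv T by (auto intro: order_trans[OF norm_ge_zero])
        fix z assume "z \<in> closed_segment (Complex u y) (Complex v y)"
        then have "Im z = y" "Re z \<in> closed_segment u v"
          by (auto simp: closed_segment_same_Im)
        moreover have "closed_segment u v = {c1..c2}"
          using uv(1) c by (auto simp: doubleton_eq_iff closed_segment_eq_real_ivl)
        ultimately show "norm (H z) \<le> D T"
          using decay[of "Re z" y] uv(2) T by (auto simp: complex_surj)
      qed
      also have "norm (Complex v y - Complex u y) = \<bar>v - u\<bar>"
        by (simp add: cmod_def)
      also have "\<bar>v - u\<bar> = c2 - c1"
        using uv(1) c by (auto simp: doubleton_eq_iff)
      finally show ?thesis .
    qed
    ultimately have "\<i> * I c2 T - \<i> * I c1 T - 2 * pi * \<i> * ?R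
        = - (contour_integral (linepath ?p1 ?p2) H + contour_integral (linepath ?p3 ?p4) H)"
      using res by (simp add: algebra_simps)
    then have "norm (\<i> * I c2 T - \<i> * I c1 T - 2 * pi * \<i> * ?R)
        \<le> norm (contour_integral (linepath ?p1 ?p2) H) + norm (contour_integral (linepath ?p3 ?p4) H)"
      by (metis norm_minus_cancel norm_triangle_ineq)
    also have "\<dots> \<le> D T * (c2 - c1) + D T * (c2 - c1)"
      using T by (intro add_mono hor cis) auto
    finally show ?thesis by (simp add: algebra_simps)
  qed
  have lim: "(\<lambda>n. I c (real n)) \<longlonglongrightarrow> (LINT y|lborel. H (Complex c y))"
    if int: "integrable lborel (\<lambda>y. H (Complex c y))" for c
    unfolding I_def by (rule tendsto_integral_symmetric_intervals[OF int])
  have "(\<lambda>n. norm (\<i> * I c2 (real n) - \<i> * I c1 (real n) - 2 * pi * \<i> * ?R))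
      \<longlonglongrightarrow> norm (\<i> * (LINT y|lborel. H (Complex c2 y)) - \<i> * (LINT y|lborel. H (Complex c1 y)) - 2 * pi * \<i> * ?R)"
    by (intro tendsto_intros lim int)
  moreover have "(\<lambda>n. norm (\<i> * I c2 (real n) - \<i> * I c1 (real n) - 2 * pi * \<i> * ?R)) \<longlonglongrightarrow> 0"
  proof (rule Lim_null_comparison)
    have "(\<lambda>n. 2 * (c2 - c1) * D (real n)) \<longlonglongrightarrow> 2 * (c2 - c1) * 0"
      by (intro tendsto_mult tendsto_const filterlim_compose[OF D filterlim_real_sequentially])
    then show "(\<lambda>n. 2 * (c2 - c1) * D (real n)) \<longlonglongrightarrow> 0" by simp
    have "eventually (\<lambda>n. real n > max (max Y Y0) 0) sequentially"
      by (rule eventually_compose_filterlim[OF eventually_gt_at_top filterlim_real_sequentially])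
    then show "eventually (\<lambda>n. norm (norm (\<i> * I c2 (real n) - \<i> * I c1 (real n) - 2 * pi * \<i> * ?R))
        \<le> 2 * (c2 - c1) * D (real n)) sequentially"
      by eventually_elim (use main in auto)
  qed
  ultimately have "norm (\<i> * (LINT y|lborel. H (Complex c2 y)) - \<i> * (LINT y|lborel. H (Complex c1 y)) - 2 * pi * \<i> * ?R) = 0"
    by (rule LIMSEQ_unique)
  then have "\<i> * ((LINT y|lborel. H (Complex c2 y)) - (LINT y|lborel. H (Complex c1 y))) = \<i> * (2 * pi * ?R)"
    by (simp add: algebra_simps)
  then show ?thesis
    by (metis complex_i_not_zero mult_left_cancel)
qed

text \<open>All residues are integrals over one fixed circle, where \<open>f\<close> is bounded and
  the multipliers converge uniformly. The nature of the singularity of \<open>f\<close> at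
  \<open>z\<close> therefore does not matter.\<close>

lemma residue_tendsto:
  fixes f :: "complex \<Rightarrow> complex" and M :: "nat \<Rightarrow> complex \<Rightarrow> complex"
  assumes U: "open U" "z \<in> U" and f: "f holomorphic_on U - {z}"
    and M: "\<And>n. M n holomorphic_on U" "L holomorphic_on U"
    and r: "r > 0" "cball z r \<subseteq> U" and lim: "uniform_limit (sphere z r) M L sequentially"
  shows "(\<lambda>n. residue (\<lambda>s. f s * M n s) z) \<longlonglongrightarrow> residue (\<lambda>s. f s * L s) z"
proof -
  have hol: "(\<lambda>s. f s * M n s) holomorphic_on U - {z}" "(\<lambda>s. f s * L s) holomorphic_on U - {z}" for n
    by (intro holomorphic_on_mult f holomorphic_on_subset[OF M(1)] holomorphic_on_subset[OF M(2)]; blast)+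
  have res: "contour_integral (circlepath z r) h = 2 * pi * \<i> * residue h z" "h contour_integrable_on circlepath z r"
    if "h holomorphic_on U - {z}" for h
    using base_residue[OF U r(1) that r(2)] by (auto intro: contour_integral_unique has_contour_integral_integrable)
  have sph: "sphere z r \<subseteq> U - {z}"
    using r by (auto simp: subset_eq)
  have bf: "bounded (f ` sphere z r)" and bL: "bounded (L ` sphere z r)"
    by (intro compact_imp_bounded compact_continuous_image compact_sphere holomorphic_on_imp_continuous_on
        holomorphic_on_subset[OF f] holomorphic_on_subset[OF M(2)]; use sph in blast)+
  have "uniform_limit (sphere z r) (\<lambda>n s. f s * M n s) (\<lambda>s. f s * L s) sequentially"
    by (intro uniform_lim_mult uniform_limit_const lim bf bL)
  then have "(\<lambda>n. contour_integral (circlepath z r) (\<lambda>s. f s * M n s))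
      \<longlonglongrightarrow> contour_integral (circlepath z r) (\<lambda>s. f s * L s)"
    using r(1) res(2)[OF hol(1)] by (intro contour_integral_uniform_limit_circlepath(2)) auto
  then have "(\<lambda>n. 2 * pi * \<i> * residue (\<lambda>s. f s * M n s) z) \<longlonglongrightarrow> 2 * pi * \<i> * residue (\<lambda>s. f s * L s) z"
    unfolding res(1)[OF hol(1)] res(1)[OF hol(2)] .
  then have "(\<lambda>n. 2 * pi * \<i> * residue (\<lambda>s. f s * M n s) z / (2 * pi * \<i>)) \<longlonglongrightarrow> 2 * pi * \<i> * residue (\<lambda>s. f s * L s) z / (2 * pi * \<i>)"
    by (rule tendsto_divide[OF _ tendsto_const]) simp
  then show ?thesis by simp
qed

section \<open>Damping factors\<close>

lemma exp_quotient_holomorphic: "exp_quotient t holomorphic_on UNIV"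
proof -
  have d: "((\<lambda>s. exp (s * of_real t)) has_field_derivative of_real t) (at 0)"
    by (auto intro!: derivative_eq_intros)
  have "(\<lambda>s::complex. if s = 0 then deriv (\<lambda>s. exp (s * of_real t)) 0
      else (exp (s * of_real t) - exp (0 * of_real t)) / (s - 0)) holomorphic_on UNIV"
    by (rule pole_lemma) (auto intro!: holomorphic_intros)
  also have "(\<lambda>s::complex. if s = 0 then deriv (\<lambda>s. exp (s * of_real t)) 0
      else (exp (s * of_real t) - exp (0 * of_real t)) / (s - 0)) = exp_quotient t"
    using DERIV_imp_deriv[OF d] by (auto simp: exp_quotient_def fun_eq_iff)
  finally show ?thesis .
qed

lemma norm_exp_quotient_le:
  assumes "1 \<le> \<bar>Im s\<bar>" "\<bar>Re s\<bar> \<le> W"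
  shows "norm (exp_quotient t s) \<le> exp (\<bar>t\<bar> * W) + 1"
proof -
  have s: "1 \<le> norm s"
    using abs_Im_le_cmod[of s] assms(1) by linarith
  have "Re s * t \<le> \<bar>t\<bar> * \<bar>Re s\<bar>"
    by (metis abs_ge_self abs_mult mult.commute)
  also have "\<dots> \<le> \<bar>t\<bar> * W"
    by (intro mult_left_mono assms) auto
  finally have "norm (exp (s * of_real t)) \<le> exp (\<bar>t\<bar> * W)"
    by simp
  then have "norm (exp (s * of_real t) - 1) \<le> exp (\<bar>t\<bar> * W) + 1"
    by (intro order_trans[OF norm_triangle_ineq4]) simp
  moreover have "norm (exp (s * of_real t) - 1) / norm s \<le> norm (exp (s * of_real t) - 1) / 1"
    by (intro divide_left_mono s) (use s in auto)
  moreover have "s \<noteq> 0" using s by auto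
  ultimately show ?thesis
    by (simp add: exp_quotient_def norm_divide)
qed

definition strip_damping :: "real \<Rightarrow> real \<Rightarrow> real \<Rightarrow> complex \<Rightarrow> complex" where
  "strip_damping K m \<epsilon> s = exp (of_real \<epsilon> * - cos (of_real K * (s - of_real m)))"

text \<open>\<open>Re (cos (u + \<i> * v)) = cos u * cosh v\<close>. Since
  \<open>K * (b - a) < pi\<close>, the distance from the centre, scaled by \<open>K\<close>, stays
  below \<open>pi / 2\<close>; the cosine is then bounded below by its positive value at the edge,
  and cosh is at least half an exponential.\<close>

lemma norm_strip_damping_le:
  assumes K: "K > 0" "K * (b - a) < pi" and x: "a \<le> x" "x \<le> b" and \<epsilon>: "\<epsilon> \<ge> 0"
  shows "norm (strip_damping K ((a + b) / 2) \<epsilon> (Complex x y))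
    \<le> exp (- (\<epsilon> * cos (K * (b - a) / 2) / 2 * exp (K * \<bar>y\<bar>)))"
    and "norm (strip_damping K ((a + b) / 2) \<epsilon> (Complex x y)) \<le> 1"
    and "cos (K * (b - a) / 2) > 0"
proof -
  have ab: "a \<le> b" using x by simp
  have "\<bar>x - (a + b) / 2\<bar> \<le> (b - a) / 2"
    using x by (simp add: abs_le_iff field_simps)
  then have "K * \<bar>x - (a + b) / 2\<bar> \<le> K * ((b - a) / 2)"
    using K by (intro mult_left_mono) auto
  then have le: "\<bar>K * (x - (a + b) / 2)\<bar> \<le> K * (b - a) / 2"
    using K by (simp add: abs_mult)
  have pos: "0 \<le> K * (b - a) / 2" using K ab by simp
  show c0: "cos (K * (b - a) / 2) > 0"
    using K pos by (intro cos_gt_zero_pi) auto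
  have "cos (K * (b - a) / 2) \<le> cos \<bar>K * (x - (a + b) / 2)\<bar>"
    using le K pos by (intro cos_monotone_0_pi_le) auto
  then have cos_le: "cos (K * (b - a) / 2) \<le> cos (K * (x - (a + b) / 2))"
    by simp
  have "exp (K * \<bar>y\<bar>) \<le> exp (K * y) + exp (- (K * y))"
    by (cases "y \<ge> 0") (auto simp: add_increasing add_increasing2)
  then have "cos (K * (b - a) / 2) * (exp (K * \<bar>y\<bar>) / 2)
      \<le> cos (K * (x - (a + b) / 2)) * ((exp (K * y) + exp (- (K * y))) / 2)"
    by (intro mult_mono cos_le) (use c0 cos_le in auto)
  from mult_left_mono[OF this \<epsilon>]
  have "\<epsilon> * cos (K * (b - a) / 2) / 2 * exp (K * \<bar>y\<bar>)
      \<le> \<epsilon> * (cos (K * (x - (a + b) / 2)) * ((exp (K * y) + exp (- (K * y))) / 2))"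
    by (simp add: mult_ac)
  moreover have "norm (strip_damping K ((a + b) / 2) \<epsilon> (Complex x y))
      = exp (- (\<epsilon> * (cos (K * (x - (a + b) / 2)) * ((exp (K * y) + exp (- (K * y))) / 2))))"
    by (simp add: strip_damping_def Re_cos)
  ultimately show le1: "norm (strip_damping K ((a + b) / 2) \<epsilon> (Complex x y))
    \<le> exp (- (\<epsilon> * cos (K * (b - a) / 2) / 2 * exp (K * \<bar>y\<bar>)))"
    by simp
  have "0 \<le> \<epsilon> * cos (K * (b - a) / 2) / 2 * exp (K * \<bar>y\<bar>)"
    using \<epsilon> c0 by simp
  then show "norm (strip_damping K ((a + b) / 2) \<epsilon> (Complex x y)) \<le> 1"
    using le1 by (meson order_trans exp_le_one_iff neg_le_0_iff_le)
qed

text \<open>Covers both smoothing factors: each is the exponential of a vanishing real multiple of a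
  function that is bounded on a circle.\<close>

lemma uniform_limit_exp_scaled:
  fixes w :: "complex \<Rightarrow> complex"
  assumes w: "bounded (w ` S)" and e: "e \<longlonglongrightarrow> 0"
  shows "uniform_limit S (\<lambda>n s. exp (of_real (e n) * w s)) (\<lambda>_. 1) sequentially"
proof (rule uniform_limitI)
  fix \<epsilon> :: real assume \<epsilon>: "\<epsilon> > 0"
  have "isCont (exp :: complex \<Rightarrow> complex) 0" by simp
  then obtain \<delta> where \<delta>: "\<delta> > 0" "\<And>z::complex. norm z < \<delta> \<Longrightarrow> dist (exp z) 1 < \<epsilon>"
    using \<epsilon> unfolding continuous_at_eps_delta by (auto simp: dist_norm)
  obtain W where W: "W > 0" "\<And>s. s \<in> S \<Longrightarrow> norm (w s) \<le> W"
    using w unfolding bounded_pos by blast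
  have "eventually (\<lambda>n. norm (e n) < \<delta> / W) sequentially"
    using tendstoD[OF e, of "\<delta> / W"] \<delta> W by simp
  then show "eventually (\<lambda>n. \<forall>s\<in>S. dist (exp (of_real (e n) * w s)) 1 < \<epsilon>) sequentially"
  proof eventually_elim
    case (elim n)
    have "norm (of_real (e n) * w s) < \<delta>" if "s \<in> S" for s
    proof -
      have "norm (of_real (e n) * w s) \<le> \<bar>e n\<bar> * W"
        using W(2)[OF that] by (simp add: norm_mult mult_left_mono)
      also have "\<dots> < \<delta>" using elim W by (simp add: field_simps)
      finally show ?thesis .
    qed
    then show ?case using \<delta>(2) by blast
  qed
qed

text \<open>Factoring \<open>exp (K * T)\<close> out of the exponent leaves
  \<open>B - e * exp ((K' - K) * T)\<close>, which tends to minus infinity for any \<open>B\<close>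
  because \<open>K < K'\<close> strictly.\<close>

lemma double_exponential_tendsto_0:
  fixes B K K' e :: real
  assumes "K > 0" "K < K'" "e > 0"
  shows "((\<lambda>T. exp (B * exp (K * T)) * exp (- (e * exp (K' * T)))) \<longlongrightarrow> 0) at_top"
proof -
  have 1: "filterlim (\<lambda>T. exp (K * T)) at_top at_top"
    by (intro filterlim_compose[OF exp_at_top] filterlim_tendsto_pos_mult_at_top[OF tendsto_const assms(1)] filterlim_ident)
  have "filterlim (\<lambda>T. exp ((K' - K) * T)) at_top at_top"
    by (intro filterlim_compose[OF exp_at_top] filterlim_tendsto_pos_mult_at_top[OF tendsto_const _ filterlim_ident]) (use assms in auto)
  then have "filterlim (\<lambda>T. e * exp ((K' - K) * T)) at_top at_top"
    by (intro filterlim_tendsto_pos_mult_at_top[OF tendsto_const assms(3)])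
  then have "filterlim (\<lambda>T. - B + e * exp ((K' - K) * T)) at_top at_top"
    by (rule filterlim_tendsto_add_at_top[OF tendsto_const])
  then have "filterlim (\<lambda>T. exp (K * T) * (- B + e * exp ((K' - K) * T))) at_top at_top"
    by (rule filterlim_at_top_mult_at_top[OF 1])
  then have "((\<lambda>T. exp (- (exp (K * T) * (- B + e * exp ((K' - K) * T))))) \<longlongrightarrow> 0) at_top"
    by (intro filterlim_compose[OF exp_at_bot]) (simp add: filterlim_uminus_at_top)
  also have "(\<lambda>T. exp (- (exp (K * T) * (- B + e * exp ((K' - K) * T)))))
      = (\<lambda>T. exp (B * exp (K * T)) * exp (- (e * exp (K' * T))))"
    by (intro ext) (simp add: algebra_simps flip: exp_add)
  finally show ?thesis .
qed

lemma phragmen_lindelofE: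
  assumes "phragmen_lindelof F a b" "a < 0" "0 < b"
  obtains a' b' A B Y K where "a = ereal a'" "b = ereal b'" "a' < 0" "0 < b'"
    "A > 0" "K > 0" "K < pi / (b' - a')"
    "\<And>x y. a' < x \<Longrightarrow> x < b' \<Longrightarrow> Y \<le> \<bar>y\<bar> \<Longrightarrow> norm (F (Complex x y)) \<le> A * exp (B * exp (K * \<bar>y\<bar>))"
proof -
  obtain A B Y K where PL: "A > 0" "0 < K" "ereal K < ereal pi / \<bar>b - a\<bar>"
    "\<And>x y. a < ereal x \<Longrightarrow> ereal x < b \<Longrightarrow> Y \<le> \<bar>y\<bar> \<Longrightarrow> norm (F (Complex x y)) \<le> A * exp (B * exp (K * \<bar>y\<bar>))"
    using assms(1) unfolding phragmen_lindelof_def by blast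
  \<comment> \<open>For an infinite width the quotient is 0 and \<open>K\<close> could not be
    positive, so both endpoints are finite.\<close>
  have "\<bar>b - a\<bar> \<noteq> \<infinity>"
    using PL(2,3) by auto
  then have fin: "a \<noteq> -\<infinity>" "b \<noteq> \<infinity>"
    using assms(2,3) by (cases a; cases b; auto)+
  obtain a' where a': "a = ereal a'" using fin assms(2) by (cases a) auto
  obtain b' where b': "b = ereal b'" using fin assms(3) by (cases b) auto
  show ?thesis
  proof (rule that[OF a' b' _ _ PL(1,2)])
    show ab: "a' < 0" "0 < b'" using assms(2,3) a' b' by auto
    show "K < pi / (b' - a')"
      using PL(3) ab unfolding a' b' by simp
  qed (use PL(4) a' b' in auto)
qed

lemma gauss_factor_holomorphic: "gauss_factor \<tau> holomorphic_on S"
  unfolding gauss_factor_def[abs_def] by (intro holomorphic_intros)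

lemma strip_damping_holomorphic: "strip_damping K m \<epsilon> holomorphic_on S"
  unfolding strip_damping_def[abs_def] by (intro holomorphic_intros)

section \<open>The difference of the determining functions as a sum of residues\<close>

theorem corollary3p3:
  fixes F :: "complex \<Rightarrow> complex" and \<mu>l \<mu>r :: "real \<Rightarrow> complex"
    and a b :: ereal and N :: nat and p :: "nat \<Rightarrow> real" and t :: real
  assumes "a < 0" and "0 < b"
    and "F meromorphic_on strip a b"
    and "inj_on p {1..N}"
    and "{s \<in> strip a b. is_pole F s} = (\<lambda>n. \<i> * of_real (p n)) ` {1..N}"
    and "F holomorphic_on strip a b - (\<lambda>n. \<i> * of_real (p n)) ` {1..N}"
    and "laplace_pair F \<mu>l \<mu>r a b"
    and "phragmen_lindelof F a b"
  shows "\<mu>r t - \<mu>l t =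
    (\<Sum>n = 1..N. residue (\<lambda>s. (exp (s * of_real t) - 1) * (F s / s)) (\<i> * of_real (p n)))"
proof -
  obtain a' b' A B Y K where ab: "a = ereal a'" "b = ereal b'" "a' < 0" "0 < b'"
    and K: "A > 0" "K > 0" "K < pi / (b' - a')"
    and PL: "\<And>x y. a' < x \<Longrightarrow> x < b' \<Longrightarrow> Y \<le> \<bar>y\<bar> \<Longrightarrow> norm (F (Complex x y)) \<le> A * exp (B * exp (K * \<bar>y\<bar>))"
    by (rule phragmen_lindelofE[OF assms(8,1,2)]) (rule that)
  define U where "U = {s. a' < Re s \<and> Re s < b'}"
  have U: "strip a b = U" "open U"
    using connected_open_vertical_strip(2)[of a' b'] by (auto simp: strip_def ab U_def)
  define S where "S = (\<lambda>n. \<i> * complex_of_real (p n)) ` {1..N}"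
  have S: "finite S" "\<And>z. z \<in> S \<Longrightarrow> Re z = 0" "S \<subseteq> U"
    using ab by (auto simp: S_def U_def)
  have F: "F holomorphic_on U - S"
    using assms(6) by (simp add: U S_def)
  define q where "q s = exp_quotient t s * F s" for s
  have q: "q holomorphic_on U - S"
    unfolding q_def by (intro holomorphic_intros F holomorphic_on_subset[OF exp_quotient_holomorphic]) auto
  \<comment> \<open>The midpoint between \<open>K\<close> and \<open>pi / (b' - a')\<close>: large
    enough to outgrow \<open>F\<close>, small enough for the cosine to stay positive on the
    strip.\<close>
  define K' where "K' = (K + pi / (b' - a')) / 2"
  have "K < K'" "K' < pi / (b' - a')"
    using less_half_sum[OF K(3)] gt_half_sum[OF K(3)] by (simp_all add: K'_def)
  then have K': "K < K'" "K' > 0" "K' * (b' - a') < pi"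
    using K(2) ab by (simp_all add: pos_less_divide_eq)
  define m where "m = (a' + b') / 2"
  \<comment> \<open>One sequence serves twice: with index \<open>n\<close> as the Gaussian width,
    with index \<open>k\<close> as the damping strength.\<close>
  define \<tau> where "\<tau> n = inverse (real (Suc n))" for n
  have \<tau>: "\<tau> n > 0" "\<tau> n \<le> 1" "\<tau> \<longlonglongrightarrow> 0" for n
    using LIMSEQ_inverse_real_of_nat by (auto simp: \<tau>_def[abs_def] field_simps)
  let ?h = "\<lambda>c n y. q (Complex c y) * gauss_factor (\<tau> n) (Complex c y)"
  let ?\<phi> = "\<lambda>k. strip_damping K' m (\<tau> k)"
  \<comment> \<open>Inversion needs two abscissas that enclose the line within the same half strip;
    the quarter points on either side of \<open>a' / 2\<close> provide them, and similarly for
    \<open>b' / 2\<close>.\<close>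
  have L: "integrable lborel (?h (a' / 2) n)" "(\<lambda>n. LINT y|lborel. ?h (a' / 2) n y) \<longlonglongrightarrow> 2 * pi * \<mu>l t" for n
    unfolding q_def
    by (rule laplace_stieltjes_line_inversion[of \<mu>l "3 * a' / 4" "a' / 2" "a' / 4", OF _ _ _ _ _ \<tau>];
        use assms(7) ab in \<open>auto simp: laplace_pair_def strip_def zero_less_mult_iff mult_neg_neg\<close>)+
  have R: "integrable lborel (?h (b' / 2) n)" "(\<lambda>n. LINT y|lborel. ?h (b' / 2) n y) \<longlonglongrightarrow> 2 * pi * \<mu>r t" for n
    unfolding q_def
    by (rule laplace_stieltjes_line_inversion[of \<mu>r "b' / 4" "b' / 2" "3 * b' / 4", OF _ _ _ _ _ \<tau>];
        use assms(7) ab in \<open>auto simp: laplace_pair_def strip_def\<close>)+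
  have \<phi>meas [measurable]: "(\<lambda>y. ?\<phi> k (Complex c y)) \<in> borel_measurable borel" for k c
    unfolding strip_damping_def by measurable
  have \<phi>1: "norm (?\<phi> k (Complex c y)) \<le> 1" if "a' \<le> c" "c \<le> b'" for k c y
    unfolding m_def by (rule norm_strip_damping_le(2)[OF K'(2,3) that]) (simp add: \<tau>_def)
  have damped_int: "integrable lborel (\<lambda>y. ?h c n y * ?\<phi> k (Complex c y))"
    if int: "integrable lborel (?h c n)" and c: "a' \<le> c" "c \<le> b'" for c n k
  proof (rule Bochner_Integration.integrable_bound[OF int])
    show "AE y in lborel. norm (?h c n y * ?\<phi> k (Complex c y)) \<le> norm (?h c n y)"
      using \<phi>1[OF c] by (intro AE_I2) (simp add: norm_mult mult_left_le)
    show "(\<lambda>y. ?h c n y * ?\<phi> k (Complex c y)) \<in> borel_measurable lborel"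
      using borel_measurable_integrable[OF int] by measurable
  qed
  have \<phi>lim: "(\<lambda>k. LINT y|lborel. ?h c n y * ?\<phi> k (Complex c y)) \<longlonglongrightarrow> (LINT y|lborel. ?h c n y)"
    if int: "integrable lborel (?h c n)" and c: "a' \<le> c" "c \<le> b'" for c n
  proof (rule integral_dominated_convergence)
    show "integrable lborel (\<lambda>y. norm (?h c n y))" using int by simp
    show "AE y in lborel. (\<lambda>k. ?h c n y * ?\<phi> k (Complex c y)) \<longlonglongrightarrow> ?h c n y"
    proof (rule AE_I2)
      fix y
      have "(\<lambda>k. ?h c n y * ?\<phi> k (Complex c y)) \<longlonglongrightarrow> ?h c n y * exp (of_real 0 * - cos (of_real K' * (Complex c y - of_real m)))"
        unfolding strip_damping_def by (intro tendsto_intros \<tau>(3))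
      then show "(\<lambda>k. ?h c n y * ?\<phi> k (Complex c y)) \<longlonglongrightarrow> ?h c n y" by simp
    qed
    show "AE y in lborel. norm (?h c n y * ?\<phi> k (Complex c y)) \<le> norm (?h c n y)" for k
      using \<phi>1[OF c] by (intro AE_I2) (simp add: norm_mult mult_left_le)
  qed (use borel_measurable_integrable[OF int] in measurable)
  have contour: "(LINT y|lborel. ?h (b' / 2) n y * ?\<phi> k (Complex (b' / 2) y))
      - (LINT y|lborel. ?h (a' / 2) n y * ?\<phi> k (Complex (a' / 2) y))
      = 2 * pi * (\<Sum>z\<in>S. residue (\<lambda>s. q s * (gauss_factor (\<tau> n) s * ?\<phi> k s)) z)" for n k
  proof -
    define H where "H s = q s * (gauss_factor (\<tau> n) s * ?\<phi> k s)" for s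
    have hH: "?h c n y * ?\<phi> k (Complex c y) = H (Complex c y)" for c y
      by (simp add: H_def)
    define W where "W = max \<bar>a'\<bar> b'"
    define e where "e = \<tau> k * cos (K' * (b' - a') / 2) / 2"
    have e: "e > 0"
      using norm_strip_damping_le(3)[OF K'(2,3), of a' 0] ab \<tau>(1)[of k] by (simp add: e_def)
    \<comment> \<open>\<open>Q\<close> collects the bounds that do not grow with the height: that of
      \<open>exp_quotient\<close>, the constant \<open>A\<close>, and the Gaussian factor;
      \<open>W\<close> bounds \<open>\<bar>Re s\<bar>\<close> on the strip. The coefficient
      \<open>e\<close> is the one produced by \<open>norm_strip_damping_le\<close>.\<close>
    define Q where "Q = (exp (\<bar>t\<bar> * W) + 1) * A * exp ((\<tau> n)\<^sup>2 * W\<^sup>2 / 2)"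
    define D where "D T = Q * (exp (B * exp (K * T)) * exp (- (e * exp (K' * T))))" for T
    have "(LINT y|lborel. H (Complex (b' / 2) y)) - (LINT y|lborel. H (Complex (a' / 2) y))
        = 2 * pi * (\<Sum>z\<in>S. residue H z)"
    proof (rule strip_contour_shift[where a = a' and b = b' and D = D and Y = "max Y 1"])
      show "H holomorphic_on {s. a' < Re s \<and> Re s < b'} - S"
        unfolding H_def U_def[symmetric]
        by (intro holomorphic_intros q gauss_factor_holomorphic strip_damping_holomorphic)
      show "integrable lborel (\<lambda>y. H (Complex (a' / 2) y))" "integrable lborel (\<lambda>y. H (Complex (b' / 2) y))"
        unfolding hH[symmetric] using ab by (intro damped_int L(1) R(1); simp)+
      have "(D \<longlongrightarrow> Q * 0) at_top"
        unfolding D_def by (intro tendsto_mult tendsto_const double_exponential_tendsto_0 K(2) K'(1) e)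
      then show "(D \<longlongrightarrow> 0) at_top" by simp
      \<comment> \<open>The maximum with 1 in the threshold is for the bound of
        \<open>exp_quotient\<close>, which needs \<open>1 \<le> \<bar>Im s\<bar>\<close>.\<close>
      show "norm (H (Complex x y)) \<le> D \<bar>y\<bar>" if xy: "a' / 2 \<le> x" "x \<le> b' / 2" "max Y 1 \<le> \<bar>y\<bar>" for x y
      proof -
        have x: "a' < x" "x < b'" "\<bar>x\<bar> \<le> W" using xy ab by (auto simp: W_def)
        have 1: "norm (exp_quotient t (Complex x y)) \<le> exp (\<bar>t\<bar> * W) + 1"
          by (rule norm_exp_quotient_le) (use xy x in auto)
        have 2: "norm (F (Complex x y)) \<le> A * exp (B * exp (K * \<bar>y\<bar>))"
          using PL[of x y] x xy by simp
        have "\<bar>x\<bar>\<^sup>2 \<le> W\<^sup>2"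
          by (rule power_mono[OF x(3)]) simp
        then have "x\<^sup>2 \<le> W\<^sup>2" by simp
        \<comment> \<open>The Gaussian decay in \<open>y\<close> is given away here; against a
          double exponential only the damping factor helps.\<close>
        then have 3: "norm (gauss_factor (\<tau> n) (Complex x y)) \<le> exp ((\<tau> n)\<^sup>2 * W\<^sup>2 / 2) * 1"
          unfolding norm_gauss_factor_line by (intro mult_mono) (auto intro: mult_left_mono)
        have 4: "norm (?\<phi> k (Complex x y)) \<le> exp (- (e * exp (K' * \<bar>y\<bar>)))"
          unfolding m_def e_def
          by (rule norm_strip_damping_le(1)[OF K'(2,3)]) (use x \<tau>(1)[of k] in auto)
        have "norm (H (Complex x y)) \<le> ((exp (\<bar>t\<bar> * W) + 1) * (A * exp (B * exp (K * \<bar>y\<bar>))))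
            * ((exp ((\<tau> n)\<^sup>2 * W\<^sup>2 / 2) * 1) * exp (- (e * exp (K' * \<bar>y\<bar>))))"
          unfolding H_def q_def norm_mult
          by (intro mult_mono 1 2 3 4) (use K(1) in \<open>auto intro!: add_nonneg_nonneg mult_nonneg_nonneg\<close>)
        also have "\<dots> = D \<bar>y\<bar>" by (simp add: D_def Q_def)
        finally show ?thesis .
      qed
    qed (use ab S(1) S(2) in auto)
    then show ?thesis
      unfolding hH H_def[abs_def] .
  qed
  have nbhd: "\<exists>V r. open V \<and> z \<in> V \<and> q holomorphic_on V - {z} \<and> r > 0 \<and> cball z r \<subseteq> V" if z: "z \<in> S" for z
  proof -
    \<comment> \<open>Taking out the other poles leaves an open set in which \<open>z\<close> is the
      only singularity of \<open>q\<close>.\<close>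
    let ?V = "U - (S - {z})"
    have V: "open ?V" "z \<in> ?V"
      using U(2) S(1,3) z by (auto intro: open_Diff finite_imp_closed)
    moreover obtain r where "r > 0" "cball z r \<subseteq> ?V"
      using V open_contains_cball by blast
    moreover have "q holomorphic_on ?V - {z}"
      by (rule holomorphic_on_subset[OF q]) auto
    ultimately show ?thesis by blast
  qed
  have bdd: "bounded (f ` sphere z r)" if "continuous_on UNIV f" for f :: "complex \<Rightarrow> complex" and z r
    by (intro compact_imp_bounded compact_continuous_image compact_sphere continuous_on_subset[OF that]) auto
  have res_k: "(\<lambda>k. residue (\<lambda>s. q s * (gauss_factor (\<tau> n) s * ?\<phi> k s)) z)
      \<longlonglongrightarrow> residue (\<lambda>s. q s * gauss_factor (\<tau> n) s) z" if z: "z \<in> S" for z n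
  proof -
    obtain V r where V: "open V" "z \<in> V" "q holomorphic_on V - {z}" "r > 0" "cball z r \<subseteq> V"
      using nbhd[OF z] by blast
    show ?thesis
    proof (rule residue_tendsto[OF V(1-3) _ _ V(4,5)])
      have "uniform_limit (sphere z r) ?\<phi> (\<lambda>_. 1) sequentially"
        unfolding strip_damping_def
        by (intro uniform_limit_exp_scaled bdd \<tau>(3) continuous_intros)
      then have "uniform_limit (sphere z r) (\<lambda>k s. gauss_factor (\<tau> n) s * ?\<phi> k s) (\<lambda>s. gauss_factor (\<tau> n) s * 1) sequentially"
        by (intro uniform_lim_mult uniform_limit_const bdd holomorphic_on_imp_continuous_on[OF gauss_factor_holomorphic]
            continuous_on_const)
      then show "uniform_limit (sphere z r) (\<lambda>k s. gauss_factor (\<tau> n) s * ?\<phi> k s) (gauss_factor (\<tau> n)) sequentially"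
        by simp
    qed (intro holomorphic_intros gauss_factor_holomorphic strip_damping_holomorphic)+
  qed
  have res_n: "(\<lambda>n. residue (\<lambda>s. q s * gauss_factor (\<tau> n) s) z) \<longlonglongrightarrow> residue (\<lambda>s. q s * 1) z" if z: "z \<in> S" for z
  proof -
    obtain V r where V: "open V" "z \<in> V" "q holomorphic_on V - {z}" "r > 0" "cball z r \<subseteq> V"
      using nbhd[OF z] by blast
    show ?thesis
    proof (rule residue_tendsto[OF V(1-3) _ _ V(4,5)])
      have "(\<lambda>n. (\<tau> n)\<^sup>2 / 2) \<longlonglongrightarrow> 0\<^sup>2 / 2"
        by (intro tendsto_intros \<tau>(3)) auto
      then show "uniform_limit (sphere z r) (\<lambda>n. gauss_factor (\<tau> n)) (\<lambda>_. 1) sequentially"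
        unfolding gauss_factor_def[abs_def]
        by (intro uniform_limit_exp_scaled bdd continuous_intros) simp
    qed (intro holomorphic_intros gauss_factor_holomorphic)+
  qed
  \<comment> \<open>Here \<open>k\<close> tends to infinity for fixed \<open>n\<close>, on the lines
    by dominated convergence and at the poles by uniform convergence on circles.\<close>
  have eq_n: "(LINT y|lborel. ?h (b' / 2) n y) - (LINT y|lborel. ?h (a' / 2) n y)
      = 2 * pi * (\<Sum>z\<in>S. residue (\<lambda>s. q s * gauss_factor (\<tau> n) s) z)" for n
  proof (rule LIMSEQ_unique)
    show "(\<lambda>k. (LINT y|lborel. ?h (b' / 2) n y * ?\<phi> k (Complex (b' / 2) y))
        - (LINT y|lborel. ?h (a' / 2) n y * ?\<phi> k (Complex (a' / 2) y)))
        \<longlonglongrightarrow> (LINT y|lborel. ?h (b' / 2) n y) - (LINT y|lborel. ?h (a' / 2) n y)"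
      using ab by (intro tendsto_diff \<phi>lim L(1) R(1)) auto
    show "(\<lambda>k. (LINT y|lborel. ?h (b' / 2) n y * ?\<phi> k (Complex (b' / 2) y))
        - (LINT y|lborel. ?h (a' / 2) n y * ?\<phi> k (Complex (a' / 2) y)))
        \<longlonglongrightarrow> 2 * pi * (\<Sum>z\<in>S. residue (\<lambda>s. q s * gauss_factor (\<tau> n) s) z)"
      unfolding contour by (intro tendsto_mult tendsto_const tendsto_sum res_k)
  qed
  have "2 * pi * \<mu>r t - 2 * pi * \<mu>l t = 2 * pi * (\<Sum>z\<in>S. residue (\<lambda>s. q s * 1) z)"
  proof (rule LIMSEQ_unique)
    show "(\<lambda>n. (LINT y|lborel. ?h (b' / 2) n y) - (LINT y|lborel. ?h (a' / 2) n y)) \<longlonglongrightarrow> 2 * pi * \<mu>r t - 2 * pi * \<mu>l t"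
      by (intro tendsto_diff L(2) R(2))
    show "(\<lambda>n. (LINT y|lborel. ?h (b' / 2) n y) - (LINT y|lborel. ?h (a' / 2) n y))
        \<longlonglongrightarrow> 2 * pi * (\<Sum>z\<in>S. residue (\<lambda>s. q s * 1) z)"
      unfolding eq_n by (intro tendsto_mult tendsto_const tendsto_sum res_n)
  qed
  then have "complex_of_real (2 * pi) * (\<mu>r t - \<mu>l t) = of_real (2 * pi) * (\<Sum>z\<in>S. residue (\<lambda>s. q s * 1) z)"
    by (simp add: right_diff_distrib)
  then have "\<mu>r t - \<mu>l t = (\<Sum>z\<in>S. residue (\<lambda>s. q s * 1) z)"
    by (rule mult_left_cancel[THEN iffD1, rotated]) simp
  also have "\<dots> = (\<Sum>n = 1..N. residue (\<lambda>s. q s * 1) (\<i> * of_real (p n)))"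
    unfolding S_def
  proof (subst sum.reindex)
    show "inj_on (\<lambda>n. \<i> * complex_of_real (p n)) {1..N}"
      using assms(4) unfolding inj_on_def by (metis complex_i_not_zero mult_left_cancel of_real_eq_iff)
  qed simp
  also have "\<dots> = (\<Sum>n = 1..N. residue (\<lambda>s. (exp (s * of_real t) - 1) * (F s / s)) (\<i> * of_real (p n)))"
  \<comment> \<open>A residue depends only on a punctured neighbourhood, so the value filled in by
    \<open>exp_quotient\<close> at the origin is harmless even when \<open>p n = 0\<close>.\<close>
  proof (intro sum.cong refl residue_cong)
    fix n
    have "eventually (\<lambda>s. s \<noteq> 0) (at (\<i> * complex_of_real (p n)))"
      by (rule eventually_neq_at_within)
    then show "eventually (\<lambda>s. q s * 1 = (exp (s * of_real t) - 1) * (F s / s)) (at (\<i> * complex_of_real (p n)))"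
      by eventually_elim (simp add: q_def exp_quotient_def)
  qed
  finally show ?thesis .
qed

end
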